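(* Let $d,m\ge1$ be integers, let $\Phi_0,\Phi_1\in\mathcal S_m^+(\mathbb T^d)$, and let $\Omega(e^{j\boldsymbol\vartheta})=H(e^{j\boldsymbol\vartheta})H(e^{j\boldsymbol\vartheta})^*$ be a weight function with $\Omega(e^{j\boldsymbol\vartheta})>0$ for all $\boldsymbol\vartheta\in\mathbb T^d$, where $H(e^{j\boldsymbol\vartheta})=\sum_{\mathbf t\in\mathbb Z^d}H_{\mathbf t}e^{-j\langle\boldsymbol\vartheta,\mathbf t\rangle}$ with $H_{\mathbf t}\in\mathbb R^{m\times m}$ absolutely summable. Define, pointwise in $\boldsymbol\vartheta$, $$U_\Omega=\Phi_1^{-1/2}\,\Omega^{-1}\,\Phi_0^{-1/2}\big(\Phi_0^{1/2}\,\Omega\,\Phi_1\,\Omega\,\Phi_0^{1/2}\big)^{1/2}.$$ Then $U_\Omega$ is all-pass, i.e. $U_\Omega U_\Omega^*=I$, and the weighted Hellinger distance satisfies $$d_\Omega(\Phi_0,\Phi_1)^2=\int_{\mathbb T^d}\big\|\Phi_0^{1/2}-\Phi_1^{1/2}U_\Omega\big\|_\Omega^2\,\mathrm d\mu .$$ Moreover, the path $$\Phi_\tau=\big[(1-\tau)\Phi_0^{1/2}+\tau\,\Phi_1^{1/2}U_\Omega\big]\big[(1-\tau)\Phi_0^{1/2}+\tau\,\Phi_1^{1/2}U_\Omega\big]^*,\qquad \tau\in[0,1],$$ is a geodesic connecting $\Phi_0$ and $\Phi_1$ on $\mathcal S_m^+(\mathbb T^d)$ with respect to $d_\Omega$.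
   Context: Notation: $\mathbb T^d=[0,2\pi]^d$; $\mathrm d\mu(\boldsymbol\vartheta)=\frac{1}{(2\pi)^d}\prod_{k=1}^d\mathrm d\vartheta_k$; $j$ is the imaginary unit; $A^*$ is the conjugate transpose; $A>0$ means Hermitian positive definite; $A^{1/2}$ is the Hermitian positive semidefinite square root; $\|A\|_W=\sqrt{\operatorname{tr}(A^*WA)}$ for $W=W^*>0$. All operations on matrix functions of $\boldsymbol\vartheta$ are pointwise. $\mathcal S_m^+(\mathbb T^d)$ is the set of bounded and coercive power spectral densities of $\mathbb R^m$-valued stationary random fields on $\mathbb Z^d$: measurable Hermitian $m\times m$ matrix functions $\Phi$ on $\mathbb T^d$ with real Fourier coefficients (matrices in $\mathbb R^{m\times m}$) such that $cI\le\Phi(e^{j\boldsymbol\vartheta})\le CI$ for (almost) all $\boldsymbol\vartheta$, for some constants $0<c\le C<\infty$. For $\Phi,\Psi\in\mathcal S_m^+(\mathbb T^d)$ the weighted Hellinger distance with weight $\Omega$ is the nonnegative number $d_\Omega(\Phi,\Psi)$ with $$d_\Omega(\Phi,\Psi)^2=\operatorname{tr}\int_{\mathbb T^d}\Big(\Omega\Phi+\Omega\Psi-2\big(\Phi^{1/2}\,\Omega\,\Psi\,\Omega\,\Phi^{1/2}\big)^{1/2}\Big)\mathrm d\mu .$$ A path $(\Phi_\tau)_{\tau\in[0,1]}$ in $\mathcal S_m^+(\mathbb T^d)$ is a geodesic for $d_\Omega$ connecting $\Phi_0$ and $\Phi_1$ if it has these endpoints and $d_\Omega(\Phi_\sigma,\Phi_\tau)=|\sigma-\tau|\,d_\Omega(\Phi_0,\Phi_1)$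 for all $\sigma,\tau\in[0,1]$. *)

theory Defs
  imports "HOL-Analysis.Analysis"
begin

section \<open>Complex matrices\<close>

definition conj_transpose :: "complex^'n^'m \<Rightarrow> complex^'m^'n"
  where "conj_transpose A = (\<chi> i j. cnj (A $ j $ i))"

definition hermitian :: "complex^'n^'n \<Rightarrow> bool"
  where "hermitian A \<longleftrightarrow> conj_transpose A = A"

text \<open>The sesquilinear value \<open>x\<^sup>* A x\<close>, which is real for Hermitian \<open>A\<close>.\<close>

definition quad_form :: "complex^'n^'n \<Rightarrow> complex^'n \<Rightarrow> complex"
  where "quad_form A x = (\<Sum>i\<in>UNIV. cnj (x $ i) * (A *v x) $ i)"

definition pos_semidef :: "complex^'n^'n \<Rightarrow> bool"
  where "pos_semidef A \<longleftrightarrow> hermitian A \<and> (\<forall>x. 0 \<le> Re (quad_form A x))"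

definition pos_def :: "complex^'n^'n \<Rightarrow> bool"
  where "pos_def A \<longleftrightarrow> hermitian A \<and> (\<forall>x. x \<noteq> 0 \<longrightarrow> 0 < Re (quad_form A x))"

definition loewner_le :: "complex^'n^'n \<Rightarrow> complex^'n^'n \<Rightarrow> bool"
  where "loewner_le A B \<longleftrightarrow> pos_semidef (B - A)"

text \<open>A positive semidefinite matrix has exactly one positive semidefinite square root; for any
  other argument the value is unspecified.\<close>

definition psd_sqrt :: "complex^'n^'n \<Rightarrow> complex^'n^'n"
  where "psd_sqrt A = (THE B. pos_semidef B \<and> B ** B = A)"

text \<open>For positive definite \<open>W\<close> the trace is real and nonnegative, so that \<open>Re\<close> only changes the
  type.\<close>

definition weighted_norm :: "complex^'n^'n \<Rightarrow> complex^'n^'n \<Rightarrow> real"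
  where "weighted_norm W A = sqrt (Re (trace (conj_transpose A ** W ** A)))"


section \<open>Functions on the torus\<close>

text \<open>A function of \<open>e\<^sup>j\<^sup>\<theta>\<close> is represented as a function of \<open>\<theta> \<in> [0, 2\<pi>]\<^sup>d\<close>; its values outside
  this cube are irrelevant.\<close>

definition torus :: "(real^'d) set"
  where "torus = cbox 0 (\<chi> k. 2 * pi)"

definition torus_measure :: "(real^'d) measure"
  where "torus_measure = density (lebesgue_on torus) (\<lambda>_. ennreal (1 / (2 * pi) ^ CARD('d)))"

definition pairing :: "real^'d \<Rightarrow> int^'d \<Rightarrow> real"
  where "pairing \<theta> t = (\<Sum>k\<in>UNIV. \<theta> $ k * of_int (t $ k))"

definition fourier_coeff :: "(real^'d \<Rightarrow> complex^'m^'m) \<Rightarrow> int^'d \<Rightarrow> complex^'m^'m"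
  where "fourier_coeff \<Phi> t =
    (\<integral>\<theta>. (\<chi> a b. cis (pairing \<theta> t) * \<Phi> \<theta> $ a $ b) \<partial>torus_measure)"

definition fourier_series :: "(int^'d \<Rightarrow> real^'m^'m) \<Rightarrow> real^'d \<Rightarrow> complex^'m^'m"
  where "fourier_series h \<theta> =
    (\<Sum>\<^sub>\<infinity>t. (\<chi> a b. complex_of_real (h t $ a $ b) * cis (- pairing \<theta> t)))"

text \<open>Bounded and coercive spectral densities. As usual they are considered up to null sets, so the
  pointwise conditions are imposed almost everywhere. The relation \<open>c I \<le> \<Phi> \<le> C I\<close> includes that
  the values are Hermitian.\<close>

definition spectral_densities :: "(real^'d \<Rightarrow> complex^'m^'m) set"
  where "spectral_densities = {\<Phi>.
    \<Phi> \<in> borel_measurable torus_measure \<and>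
    (\<forall>t a b. fourier_coeff \<Phi> t $ a $ b \<in> \<real>) \<and>
    (\<exists>c C. 0 < c \<and> c \<le> C \<and>
      (AE \<theta> in torus_measure.
        hermitian (\<Phi> \<theta>) \<and> loewner_le (c *\<^sub>R mat 1) (\<Phi> \<theta>) \<and> loewner_le (\<Phi> \<theta>) (C *\<^sub>R mat 1)))}"


section \<open>The weighted Hellinger distance\<close>

definition hellinger_dist ::
  "(real^'d \<Rightarrow> complex^'m^'m) \<Rightarrow> (real^'d \<Rightarrow> complex^'m^'m) \<Rightarrow> (real^'d \<Rightarrow> complex^'m^'m) \<Rightarrow> real"
  where "hellinger_dist \<Omega> \<Phi> \<Psi> = (THE r. 0 \<le> r \<and>
    complex_of_real (r\<^sup>2) =
      trace (\<integral>\<theta>. (\<Omega> \<theta> ** \<Phi> \<theta> + \<Omega> \<theta> ** \<Psi> \<theta>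
        - 2 *\<^sub>R psd_sqrt (psd_sqrt (\<Phi> \<theta>) ** \<Omega> \<theta> ** \<Psi> \<theta> ** \<Omega> \<theta> ** psd_sqrt (\<Phi> \<theta>)))
        \<partial>torus_measure))"

text \<open>The end points are attained almost everywhere, i.e. as elements of the space of densities.\<close>

definition is_hellinger_geodesic ::
  "(real^'d \<Rightarrow> complex^'m^'m) \<Rightarrow> (real \<Rightarrow> real^'d \<Rightarrow> complex^'m^'m) \<Rightarrow>
   (real^'d \<Rightarrow> complex^'m^'m) \<Rightarrow> (real^'d \<Rightarrow> complex^'m^'m) \<Rightarrow> bool"
  where "is_hellinger_geodesic \<Omega> P \<Phi>0 \<Phi>1 \<longleftrightarrow>
    (\<forall>\<tau>\<in>{0..1}. P \<tau> \<in> spectral_densities) \<and>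
    (AE \<theta> in torus_measure. P 0 \<theta> = \<Phi>0 \<theta>) \<and>
    (AE \<theta> in torus_measure. P 1 \<theta> = \<Phi>1 \<theta>) \<and>
    (\<forall>\<sigma>\<in>{0..1}. \<forall>\<tau>\<in>{0..1}.
      hellinger_dist \<Omega> (P \<sigma>) (P \<tau>) = \<bar>\<sigma> - \<tau>\<bar> * hellinger_dist \<Omega> \<Phi>0 \<Phi>1)"

definition all_pass :: "(real^'d \<Rightarrow> complex^'m^'m) \<Rightarrow> bool"
  where "all_pass U \<longleftrightarrow> (AE \<theta> in torus_measure. U \<theta> ** conj_transpose (U \<theta>) = mat 1)"

end

(* Where Phi0 and Phi1 are positive definite, put A = Phi0^(1/2), B = Phi1^(1/2), F t = (1 - t) A + t B U
   and M = (A Omega Phi1 Omega A)^(1/2). Then A Omega B U = M is positive semidefinite, hence so is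
   every (F s)^* Omega (F t), a nonnegative combination of A Omega A, M and (B U)^* Omega (B U).
   Whenever Phi = F F^*, Psi = G G^* and F^* Omega G is positive semidefinite, the trace of the
   integrand defining the distance is tr ((F - G)^* Omega (F - G)); as
   F s - F t = (t - s) (A - B U), the distances along the path are proportional.

   That the path has real Fourier coefficients is shown through the equivalent pointwise condition
   Phi(2 pi - theta) = conj Phi(theta), which square roots, products and inverses preserve. The
   equivalence rests on the uniqueness of Fourier coefficients, proved by Stone-Weierstrass. *)

theory Submission
  imports Defs
begin

subsection \<open>Matrix algebra\<close>

text \<open>The formula for \<open>U\<close> is a polar decomposition in disguise. It reads U = (A
  Omega B)^(-1) M, where M^2 is A Omega B times its adjoint; so A Omega B = M U^*, and
  \<open>U\<close> is the unitary matrix that rotates A Omega B into a positive one. Among the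
  factors G of Phi1 = G G^*, the choice G = B U is in this sense aligned with A. Staying inside the
  set of densities is the delicate point, for a segment between two invertible matrices may meet a
  singular one. Positivity of M excludes this when lengths are measured with Omega. Uniform bounds
  on Omega, which is continuous on a compact set, translate the estimate back, at the price of the
  ratio w / w' in the constant. The densities obey their bounds only almost everywhere, while
  \<open>psd_sqrt\<close> and \<open>matrix_inv\<close> are total functions given by description and
  choice. Their Borel measurability is therefore proved on the space of all matrices, through closed
  graphs instead of continuity.\<close>

lemma conj_transpose_involution [simp]: "conj_transpose (conj_transpose A) = A"
  by (simp add: conj_transpose_def vec_eq_iff)

lemma conj_transpose_mult: "conj_transpose (A ** B) = conj_transpose B ** conj_transpose A"
  by (simp add: conj_transpose_def vec_eq_iff matrix_matrix_mult_def mult.commute)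

lemma conj_transpose_add: "conj_transpose (A + B) = conj_transpose A + conj_transpose B"
  by (simp add: conj_transpose_def vec_eq_iff)

lemma conj_transpose_diff: "conj_transpose (A - B) = conj_transpose A - conj_transpose B"
  by (simp add: conj_transpose_def vec_eq_iff)

lemma conj_transpose_scaleR: "conj_transpose (r *\<^sub>R A) = r *\<^sub>R conj_transpose A"
  by (simp add: conj_transpose_def vec_eq_iff)

lemma conj_transpose_mat_1 [simp]: "conj_transpose (mat 1) = mat 1"
  by (auto simp: conj_transpose_def vec_eq_iff mat_def)

lemmas conj_transpose_simps =
  conj_transpose_mult conj_transpose_add conj_transpose_diff conj_transpose_scaleR

lemma matrix_add_rdistrib: "(A + B) ** C = A ** C + B ** (C :: 'a::semiring_1^'n^'m)"
  by (simp add: vec_eq_iff matrix_matrix_mult_def distrib_right sum.distrib)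

lemma matrix_diff_ldistrib: "A ** (B - C) = A ** B - A ** (C :: 'a::ring_1^'n^'m)"
  by (simp add: vec_eq_iff matrix_matrix_mult_def right_diff_distrib sum_subtractf)

lemma matrix_diff_rdistrib: "(A - B) ** C = A ** C - B ** (C :: 'a::ring_1^'n^'m)"
  by (simp add: vec_eq_iff matrix_matrix_mult_def left_diff_distrib sum_subtractf)

lemma matrix_mult_scaleR_left: "(k *\<^sub>R A) ** B = k *\<^sub>R (A ** (B :: complex^'n^'m))"
  by (simp add: scalar_matrix_assoc)

lemma matrix_mult_scaleR_right: "A ** (k *\<^sub>R B) = k *\<^sub>R (A ** (B :: complex^'n^'m))"
  by (simp add: matrix_scalar_ac scalar_matrix_assoc)

lemmas matrix_ring_simps = matrix_add_ldistrib matrix_add_rdistrib matrix_diff_ldistrib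
  matrix_diff_rdistrib matrix_mult_scaleR_left matrix_mult_scaleR_right

lemma matrix_vector_mult_scaleR_left: "(k *\<^sub>R A) *v x = k *\<^sub>R (A *v (x :: complex^'n))"
  by (simp add: vec_eq_iff matrix_vector_mult_def scaleR_sum_right)

lemma matrix_vector_mult_scaleR_right: "A *v (k *\<^sub>R x) = k *\<^sub>R (A *v (x :: complex^'n))"
  by (simp add: vec_eq_iff matrix_vector_mult_def scaleR_sum_right)

text \<open>Positivity concerns real parts only, so the real inner product of
  \<open>complex^'n\<close> can replace the sesquilinear form; Cauchy-Schwarz and the norm laws then
  become available.\<close>

lemma inner_complex_vec: "x \<bullet> y = Re (\<Sum>i\<in>UNIV. cnj (x $ i) * (y $ i))"
  for x y :: "complex^'n"
  by (simp add: inner_vec_def inner_complex_def)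

lemma Re_quad_form: "Re (quad_form A x) = x \<bullet> (A *v x)"
  by (simp add: quad_form_def inner_complex_vec)

lemma inner_matrix_vector: "x \<bullet> (A *v y) = (conj_transpose A *v x) \<bullet> y"
  for A :: "complex^'n^'m"
proof -
  have "(\<Sum>i\<in>UNIV. cnj (x $ i) * (A *v y) $ i) = (\<Sum>j\<in>UNIV. cnj ((conj_transpose A *v x) $ j) * y $ j)"
    unfolding matrix_vector_mult_def conj_transpose_def
    by (simp add: sum_distrib_left sum_distrib_right mult_ac) (subst sum.swap, rule refl)
  thus ?thesis by (simp add: inner_complex_vec)
qed

lemma hermitian_inner: "hermitian A \<Longrightarrow> x \<bullet> (A *v y) = (A *v x) \<bullet> y"
  by (simp add: inner_matrix_vector hermitian_def)

lemma pos_semidef_inner: "pos_semidef A \<longleftrightarrow> hermitian A \<and> (\<forall>x. 0 \<le> x \<bullet> (A *v x))"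
  by (simp add: pos_semidef_def Re_quad_form)

lemma pos_def_inner: "pos_def A \<longleftrightarrow> hermitian A \<and> (\<forall>x. x \<noteq> 0 \<longrightarrow> 0 < x \<bullet> (A *v x))"
  by (simp add: pos_def_def Re_quad_form)

lemma pos_def_imp_pos_semidef: "pos_def A \<Longrightarrow> pos_semidef A"
  unfolding pos_def_inner pos_semidef_inner by (metis inner_zero_left less_eq_real_def)

lemma loewner_le_scaleR_mat_1_left:
  "hermitian A \<Longrightarrow> loewner_le (c *\<^sub>R mat 1) A \<longleftrightarrow> (\<forall>x. c * (norm x)\<^sup>2 \<le> x \<bullet> (A *v x))"
  by (simp add: loewner_le_def pos_semidef_inner hermitian_def conj_transpose_simps
      matrix_vector_mult_diff_rdistrib matrix_vector_mult_scaleR_left inner_diff_right power2_norm_eq_inner)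

lemma loewner_le_scaleR_mat_1_right:
  "hermitian A \<Longrightarrow> loewner_le A (c *\<^sub>R mat 1) \<longleftrightarrow> (\<forall>x. x \<bullet> (A *v x) \<le> c * (norm x)\<^sup>2)"
  by (simp add: loewner_le_def pos_semidef_inner hermitian_def conj_transpose_simps
      matrix_vector_mult_diff_rdistrib matrix_vector_mult_scaleR_left inner_diff_right power2_norm_eq_inner)

lemma pos_def_invertible:
  assumes "pos_def A" shows "invertible A"
proof -
  have "\<forall>x. A *v x = 0 \<longrightarrow> x = 0"
    using assms by (metis pos_def_inner inner_zero_right less_irrefl)
  then show ?thesis
    using matrix_left_invertible_ker[of A] matrix_left_right_inverse[of _ A]
    unfolding invertible_def by blast
qed

lemma matrix_inv:
  assumes "invertible A"
  shows "A ** matrix_inv A = mat 1" "matrix_inv A ** A = mat 1"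
  using someI_ex[OF assms[unfolded invertible_def]] by (simp_all add: matrix_inv_def)

lemma matrix_inv_unique:
  assumes "A ** X = mat 1" "X ** A = mat 1"
  shows "matrix_inv A = X"
proof -
  have "invertible A" using assms by (auto simp: invertible_def)
  then have "matrix_inv A = matrix_inv A ** (A ** X)" using assms by simp
  also have "\<dots> = X" using matrix_inv(2)[OF \<open>invertible A\<close>] by (simp add: matrix_mul_assoc)
  finally show ?thesis .
qed

lemma conj_transpose_matrix_inv:
  assumes "invertible A"
  shows "conj_transpose (matrix_inv A) = matrix_inv (conj_transpose A)"
  by (rule matrix_inv_unique[symmetric])
    (simp_all add: matrix_inv[OF assms] flip: conj_transpose_mult)

section \<open>Frobenius norm, operator bounds and the trace\<close>

lemma norm_conj_transpose: "norm (conj_transpose A) = norm (A :: complex^'n^'m)"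
proof -
  have "(norm (conj_transpose A))\<^sup>2 = (norm A)\<^sup>2"
    unfolding power2_norm_eq_inner
    by (simp add: inner_vec_def conj_transpose_def inner_complex_def) (subst sum.swap, rule refl)
  then show ?thesis by simp
qed

text \<open>The norm of a matrix is here the Frobenius norm. It dominates the operator norm by
  Cauchy-Schwarz in every row.\<close>

lemma norm_matrix_vector_mult: "norm (A *v x) \<le> norm A * norm (x :: complex^'n)"
proof -
  have "norm ((A *v x) $ i) \<le> norm (A $ i) * norm x" for i
  proof -
    have "norm ((A *v x) $ i) \<le> (\<Sum>j\<in>UNIV. norm (A $ i $ j) * norm (x $ j))"
      by (auto simp: matrix_vector_mult_def norm_mult intro!: sum_norm_le)
    also have "\<dots> = (\<Sum>j\<in>UNIV. \<bar>norm (A $ i $ j)\<bar> * \<bar>norm (x $ j)\<bar>)"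
      by simp
    also have "\<dots> \<le> norm (A $ i) * norm x"
      unfolding norm_vec_def by (rule L2_set_mult_ineq)
    finally show ?thesis .
  qed
  then have "norm (A *v x) \<le> L2_set (\<lambda>i. norm (A $ i) * norm x) UNIV"
    unfolding norm_vec_def[of "A *v x"] by (intro L2_set_mono) auto
  also have "\<dots> = norm A * norm x"
    by (simp add: norm_vec_def[of A] L2_set_left_distrib)
  finally show ?thesis .
qed

lemma power2_norm_matrix: "(norm A)\<^sup>2 = (\<Sum>j\<in>UNIV. (norm (column j A))\<^sup>2)"
  for A :: "complex^'n^'m"
proof -
  have "(norm A)\<^sup>2 = (norm (conj_transpose A))\<^sup>2" by (simp add: norm_conj_transpose)
  also have "\<dots> = (\<Sum>j\<in>UNIV. (norm (column j A))\<^sup>2)"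
    unfolding power2_norm_eq_inner
    by (simp add: inner_vec_def column_def conj_transpose_def inner_complex_def)
  finally show ?thesis .
qed

lemma column_matrix_mult: "column j (A ** B) = A *v column j B"
  by (simp add: column_def matrix_matrix_mult_def matrix_vector_mult_def vec_eq_iff)

text \<open>The estimate holds column by column. Keeping the operator bound \<open>q\<close> of the
  left factor apart from Frobenius norms matters for the contraction that produces square roots: an
  operator bound can be below 1 when the Frobenius norm is not.\<close>

lemma norm_matrix_mult_le:
  fixes A :: "complex^'n^'m" and B :: "complex^'k^'n"
  assumes "\<And>x. norm (A *v x) \<le> q * norm x" "0 \<le> q"
  shows "norm (A ** B) \<le> q * norm B"
proof -
  have "(norm (A ** B))\<^sup>2 \<le> (\<Sum>j\<in>UNIV. (q * norm (column j B))\<^sup>2)"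
    unfolding power2_norm_matrix column_matrix_mult
    by (intro sum_mono power_mono assms) auto
  also have "\<dots> = (q * norm B)\<^sup>2"
    by (simp add: power_mult_distrib power2_norm_matrix sum_distrib_left)
  finally show ?thesis using assms(2) by (meson mult_nonneg_nonneg norm_ge_zero power2_le_imp_le)
qed

lemma norm_matrix_mult: "norm (A ** B) \<le> norm A * norm B"
  for A :: "complex^'n^'m" and B :: "complex^'k^'n"
  by (rule norm_matrix_mult_le) (auto intro: norm_matrix_vector_mult)

lemma Re_trace_mult_conj_transpose: "Re (trace (conj_transpose A ** A)) = (norm A)\<^sup>2"
  for A :: "complex^'n^'n"
  unfolding power2_norm_matrix power2_norm_eq_inner
  by (simp add: trace_def matrix_matrix_mult_def conj_transpose_def inner_complex_vec column_def)

lemma trace_scaleR: "trace (r *\<^sub>R A) = r *\<^sub>R trace (A :: complex^'n^'n)"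
  by (simp add: trace_def scaleR_sum_right)

lemma norm_trace_le: "norm (trace A) \<le> CARD('n) * norm (A :: complex^'n^'n)"
proof -
  have "norm (A $ i $ i) \<le> norm A" for i
    by (rule order_trans[OF Finite_Cartesian_Product.norm_nth_le Finite_Cartesian_Product.norm_nth_le])
  then have "norm (trace A) \<le> (\<Sum>i\<in>(UNIV::'n set). norm A)"
    unfolding trace_def by (intro sum_norm_le) auto
  then show ?thesis by simp
qed

lemma bounded_linear_trace: "bounded_linear (trace :: complex^'n^'n \<Rightarrow> complex)"
  by (rule bounded_linear_intro[where K = "CARD('n)"])
     (use norm_trace_le in \<open>auto simp: trace_add trace_scaleR mult.commute\<close>)

lemma bounded_bilinear_matrix_mult:
  "bounded_bilinear ((**) :: complex^'n^'m \<Rightarrow> complex^'k^'n \<Rightarrow> complex^'k^'m)"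
proof
  show "\<exists>K. \<forall>a b. norm ((a :: complex^'n^'m) ** (b :: complex^'k^'n)) \<le> norm a * norm b * K"
    by (rule exI[of _ 1]) (simp add: norm_matrix_mult)
qed (simp_all add: matrix_ring_simps)

lemma bounded_linear_conj_transpose: "bounded_linear (conj_transpose :: complex^'n^'m \<Rightarrow> _)"
  by (rule bounded_linear_intro[where K = 1]) (auto simp: conj_transpose_simps norm_conj_transpose)

lemmas continuous_on_matrix_mult [continuous_intros] =
  bounded_bilinear.continuous_on[OF bounded_bilinear_matrix_mult]
lemmas continuous_on_conj_transpose [continuous_intros] =
  bounded_linear.continuous_on[OF bounded_linear_conj_transpose]

lemma bounded_bilinear_matrix_vector_mult:
  "bounded_bilinear ((*v) :: complex^'n^'m \<Rightarrow> complex^'n \<Rightarrow> complex^'m)"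
proof
  show "\<exists>K. \<forall>a b. norm ((a :: complex^'n^'m) *v b) \<le> norm a * norm b * K"
    by (rule exI[of _ 1]) (simp add: norm_matrix_vector_mult)
qed (simp_all add: matrix_vector_mult_add_rdistrib matrix_vector_right_distrib
      matrix_vector_mult_scaleR_left matrix_vector_mult_scaleR_right)

lemmas continuous_on_matrix_vector_mult [continuous_intros] =
  bounded_bilinear.continuous_on[OF bounded_bilinear_matrix_vector_mult]

lemma borel_measurable_matrix_mult [measurable (raw)]:
  fixes f :: "'a \<Rightarrow> complex^'n^'m" and g :: "'a \<Rightarrow> complex^'k^'n"
  assumes "f \<in> borel_measurable M" "g \<in> borel_measurable M"
  shows "(\<lambda>x. f x ** g x) \<in> borel_measurable M"
  by (rule borel_measurable_continuous_Pair[OF assms]) (intro continuous_intros)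

lemma borel_measurable_conj_transpose [measurable (raw)]:
  fixes f :: "'a \<Rightarrow> complex^'n^'m"
  assumes "f \<in> borel_measurable M"
  shows "(\<lambda>x. conj_transpose (f x)) \<in> borel_measurable M"
  by (rule borel_measurable_continuous_on[OF _ assms]) (intro continuous_intros)

subsection \<open>Square roots of positive matrices\<close>

text \<open>With w = A v, the quadratic form of \<open>A\<close> along v - t w is a nonnegative
  polynomial in t with constant term 0 and slope -2 (w \<bullet> w) at 0. This forces w = 0.\<close>

lemma pos_semidef_inner_eq_0:
  assumes "pos_semidef A" "v \<bullet> (A *v v) = 0"
  shows "A *v v = 0"
proof (rule ccontr)
  assume nz: "A *v v \<noteq> 0"
  define w where "w = A *v v"
  define K where "K = w \<bullet> (A *v w)"
  have K: "0 \<le> K" and herm: "hermitian A" using assms(1) by (auto simp: K_def pos_semidef_inner)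
  have w: "0 < w \<bullet> w" using nz by (simp add: w_def)
  have vw: "v \<bullet> (A *v w) = w \<bullet> w"
    using hermitian_inner[OF herm, of v w] by (simp add: w_def)
  have wv: "w \<bullet> (A *v v) = w \<bullet> w" by (simp add: w_def)
  have "0 \<le> t\<^sup>2 * K - 2 * t * (w \<bullet> w)" for t :: real
  proof -
    have "0 \<le> (v - t *\<^sub>R w) \<bullet> (A *v (v - t *\<^sub>R w))"
      using assms(1) by (auto simp: pos_semidef_inner)
    also have "\<dots> = t\<^sup>2 * K - 2 * t * (w \<bullet> w)"
      using assms(2) vw wv
      by (simp add: matrix_vector_mult_diff_distrib matrix_vector_mult_scaleR_right inner_diff_left
          inner_diff_right K_def power2_eq_square algebra_simps)
    finally show ?thesis .
  qed
  \<comment> \<open>The added 1 keeps the denominator positive when \<open>K\<close> is 0; the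
    linear term still outweighs the quadratic one.\<close>
  moreover define t where "t = (w \<bullet> w) / (K + 1)"
  moreover have "t > 0" "w \<bullet> w = t * (K + 1)"
    using K w by (auto simp: t_def)
  ultimately have "0 \<le> t\<^sup>2 * K - 2 * t * (t * (K + 1))" by metis
  also have "\<dots> = t\<^sup>2 * (- K - 2)"
    by (simp add: algebra_simps power2_eq_square)
  also have "\<dots> < 0"
    using K \<open>t > 0\<close> by (intro mult_pos_neg) auto
  finally show False by simp
qed

lemma matrix_vector_mult_axis: "A *v axis i 1 = column i (A :: complex^'n^'m)"
  by (simp add: vec_eq_iff matrix_vector_mult_def axis_def column_def if_distrib cong: if_cong)

lemma inner_axis_matrix_axis: "axis i 1 \<bullet> (A *v axis i 1) = Re (A $ i $ i)"
  for A :: "complex^'n^'n"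
  by (simp add: matrix_vector_mult_axis inner_axis' column_def inner_complex_def)

lemma pos_semidef_conj: 
  assumes "pos_semidef A" shows "pos_semidef (conj_transpose B ** A ** B)"
  using assms
  by (auto simp: pos_semidef_inner hermitian_def conj_transpose_mult matrix_mul_assoc
      simp flip: matrix_vector_mul_assoc)
     (metis conj_transpose_involution inner_matrix_vector)

text \<open>The diagonal entries of the product are the values of the form of \<open>A\<close> at
  the columns of \<open>B\<close>. They are nonnegative with sum at most 0, so each column lies in
  the kernel of \<open>A\<close>.\<close>

lemma trace_pos_semidef_conj_eq_0:
  fixes A B :: "complex^'n^'n"
  assumes "pos_semidef A" "Re (trace (conj_transpose B ** A ** B)) \<le> 0"
  shows "A ** B = 0"
proof -
  have ps: "pos_semidef (conj_transpose B ** A ** B)" by (rule pos_semidef_conj[OF assms(1)])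
  have nn: "0 \<le> Re ((conj_transpose B ** A ** B) $ i $ i)" for i
    using ps unfolding inner_axis_matrix_axis[symmetric] by (simp add: pos_semidef_inner)
  have "(\<Sum>i\<in>UNIV. Re ((conj_transpose B ** A ** B) $ i $ i)) \<le> 0"
    using assms(2) by (simp add: trace_def)
  then have z: "Re ((conj_transpose B ** A ** B) $ i $ i) = 0" for i
    using nn sum_nonneg_eq_0_iff[of UNIV "\<lambda>i. Re ((conj_transpose B ** A ** B) $ i $ i)"]
    by (simp add: sum_nonneg order_antisym)
  have "column i (A ** B) = 0" for i
  proof -
    have "(B *v axis i 1) \<bullet> (A *v (B *v axis i 1)) = 0"
      using z[of i] unfolding inner_axis_matrix_axis[symmetric]
      by (simp add: inner_matrix_vector flip: matrix_vector_mul_assoc)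
    then have "A *v (B *v axis i 1) = 0" by (rule pos_semidef_inner_eq_0[OF assms(1)])
    then show ?thesis by (simp add: column_matrix_mult matrix_vector_mult_axis)
  qed
  then show ?thesis by (simp add: vec_eq_iff column_def)
qed

text \<open>With \<open>D = B - C\<close> one has \<open>B D + D C = 0\<close>, so that \<open>tr (D B D) + tr (D C D) = 0\<close>. Both
  traces are nonnegative, hence \<open>B D = C D = 0\<close> and \<open>D\<^sup>2 = 0\<close>.\<close>

lemma pos_semidef_square_inj:
  fixes B C :: "complex^'n^'n"
  assumes B: "pos_semidef B" and C: "pos_semidef C" and eq: "B ** B = C ** C"
  shows "B = C"
proof -
  define D where "D = B - C"
  have hD: "conj_transpose D = D"
    using B C by (simp add: D_def pos_semidef_inner hermitian_def conj_transpose_simps)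
  have "B ** D + D ** C = 0"
    using eq by (simp add: D_def matrix_ring_simps)
  then have "D ** (B ** D + D ** C) = 0" by simp
  then have "trace (D ** B ** D) + trace (D ** D ** C) = 0"
    by (simp add: matrix_add_ldistrib matrix_mul_assoc trace_0[unfolded mat_0] flip: trace_add)
  moreover have "trace (D ** D ** C) = trace (D ** C ** D)"
    by (metis matrix_mul_assoc trace_mul_sym)
  ultimately have sum0: "Re (trace (D ** B ** D)) + Re (trace (D ** C ** D)) = 0"
    by (metis plus_complex.sel(1) zero_complex.sel(1))
  have nn: "0 \<le> Re (trace (D ** A ** D))" if "pos_semidef A" for A
  proof -
    have "pos_semidef (D ** A ** D)" using pos_semidef_conj[OF that, of D] by (simp add: hD)
    then have "0 \<le> Re ((D ** A ** D) $ i $ i)" for i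
      unfolding inner_axis_matrix_axis[symmetric] by (simp add: pos_semidef_inner)
    then show ?thesis by (simp add: trace_def sum_nonneg)
  qed
  have "Re (trace (D ** B ** D)) \<le> 0" "Re (trace (D ** C ** D)) \<le> 0"
    using sum0 nn[OF B] nn[OF C] by linarith+
  then have "B ** D = 0" "C ** D = 0"
    using trace_pos_semidef_conj_eq_0[OF B, of D] trace_pos_semidef_conj_eq_0[OF C, of D]
    by (simp_all add: hD)
  then have "conj_transpose D ** D = 0" unfolding hD by (simp add: D_def matrix_diff_rdistrib)
  then have "(norm D)\<^sup>2 = 0"
    by (metis Re_trace_mult_conj_transpose mat_0 trace_0 zero_complex.sel(1))
  then show ?thesis by (simp add: D_def)
qed

text \<open>Evaluates the description at any exhibited root, even where the argument is not known to
  be positive definite.\<close>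

lemma psd_sqrt_unique:
  assumes "pos_semidef B" "B ** B = A"
  shows "psd_sqrt A = B"
  unfolding psd_sqrt_def
  by (rule the_equality) (use assms pos_semidef_square_inj in auto)

lemma closed_hermitian: "closed {A :: complex^'n^'n. hermitian A}"
  unfolding hermitian_def by (intro closed_Collect_eq continuous_intros)

lemma closed_pos_semidef: "closed {A :: complex^'n^'n. pos_semidef A}"
proof -
  have "closed {A :: complex^'n^'n. hermitian A \<and> (\<forall>x. 0 \<le> x \<bullet> (A *v x))}"
    by (intro closed_Collect_conj closed_hermitian closed_Collect_all closed_Collect_le continuous_intros)
  then show ?thesis by (simp add: pos_semidef_inner)
qed

text \<open>A positive definite matrix can be scaled so that \<open>E = I - t A\<close> has operator norm less than 1.
  Then \<open>Y \<mapsto> (E + Y\<^sup>2) / 2\<close> is a contraction, and its fixed point satisfies \<open>(I - Y)\<^sup>2 = t A\<close>.\<close>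

lemma coercive_has_sqrt:
  fixes A :: "complex^'n^'n"
  assumes herm: "hermitian A" and c: "0 < c" and coer: "\<And>x. c * (norm x)\<^sup>2 \<le> x \<bullet> (A *v x)"
  shows "\<exists>B. pos_semidef B \<and> B ** B = A"
proof -
  define N where "N = norm A + c"
  have N: "0 < N" "norm A \<le> N" "c \<le> N" using c by (auto simp: N_def add_nonneg_pos)
  \<comment> \<open>This \<open>t\<close> minimises the bound 1 - 2 t c + t^2 N^2 for the squared
    operator norm of \<open>E\<close>; the minimum is 1 - t c, which explains
    \<open>q\<close>.\<close>
  define t where "t = c / N\<^sup>2"
  have t: "0 < t" using c N by (simp add: t_def)
  define q where "q = sqrt (1 - t * c)"
  have tc: "t * c \<le> 1"
    using N c by (simp add: t_def field_simps power2_eq_square mult_mono)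
  have q: "0 \<le> q" "q < 1" "q\<^sup>2 = 1 - t * c"
    using tc t c by (auto simp: q_def)
  define E where "E = mat 1 - t *\<^sub>R A"
  have hE: "hermitian E"
    using herm by (simp add: E_def hermitian_def conj_transpose_simps)
  have E: "norm (E *v x) \<le> q * norm x" for x
  proof -
    have "(norm (A *v x))\<^sup>2 \<le> (N * norm x)\<^sup>2"
      by (intro power_mono order_trans[OF norm_matrix_vector_mult] mult_right_mono N) auto
    then have "t\<^sup>2 * (norm (A *v x))\<^sup>2 \<le> t\<^sup>2 * (N * norm x)\<^sup>2"
      by (intro mult_left_mono) auto
    also have "\<dots> = t * c * (norm x)\<^sup>2"
      using N(1) by (simp add: t_def power2_eq_square field_simps)
    finally have 1: "t\<^sup>2 * (norm (A *v x))\<^sup>2 \<le> t * c * (norm x)\<^sup>2" .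
    have 2: "t * (c * (norm x)\<^sup>2) \<le> t * (x \<bullet> (A *v x))"
      using coer[of x] t by (intro mult_left_mono) auto
    have "(norm (E *v x))\<^sup>2 = (norm x)\<^sup>2 - 2 * t * (x \<bullet> (A *v x)) + t\<^sup>2 * (norm (A *v x))\<^sup>2"
      unfolding E_def matrix_vector_mult_diff_rdistrib matrix_vector_mult_scaleR_left
        matrix_vector_mul_lid
      by (simp only: power2_norm_eq_inner inner_diff_left inner_diff_right inner_scaleR_left
          inner_scaleR_right inner_commute) (simp add: power2_eq_square algebra_simps)
    also have "\<dots> \<le> (norm x)\<^sup>2 - t * c * (norm x)\<^sup>2"
      using 1 2 by simp
    also have "\<dots> = (q * norm x)\<^sup>2"
      by (simp add: power_mult_distrib q(3) algebra_simps)
    finally show ?thesis using q by (meson mult_nonneg_nonneg norm_ge_zero power2_le_imp_le)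
  qed
  \<comment> \<open>A ball in the operator norm, although completeness and contraction are taken in
    the Frobenius norm. It is invariant because (q + q^2) / 2 \<le> q.\<close>
  define S where "S = {Y :: complex^'n^'n. hermitian Y \<and> (\<forall>x. norm (Y *v x) \<le> q * norm x)}"
  define T where "T = (\<lambda>Y. (1/2) *\<^sub>R (E + Y ** Y))"
  have "closed S"
    unfolding S_def
    by (intro closed_Collect_conj closed_hermitian closed_Collect_all closed_Collect_le continuous_intros)
  then have "complete S" by (simp add: complete_eq_closed)
  moreover have "S \<noteq> {}"
    using q by (auto simp: S_def hermitian_def conj_transpose_def vec_eq_iff intro!: exI[of _ 0])
  moreover have "T ` S \<subseteq> S"
  proof safe
    fix Y assume Y: "Y \<in> S"
    have "norm (T Y *v x) \<le> q * norm x" for x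
    proof -
      have "norm (Y *v (Y *v x)) \<le> q * (q * norm x)"
        using Y q by (auto simp: S_def intro: order_trans mult_left_mono)
      also have "\<dots> \<le> 1 * (q * norm x)"
        using q by (intro mult_right_mono) auto
      finally have "norm (E *v x + Y *v (Y *v x)) \<le> q * norm x + q * norm x"
        using E[of x] by (intro norm_triangle_le add_mono) auto
      then show ?thesis
        by (simp add: T_def matrix_vector_mult_scaleR_left matrix_vector_mult_add_rdistrib
            flip: matrix_vector_mul_assoc)
    qed
    moreover have "hermitian (T Y)"
      using Y hE by (simp add: S_def T_def hermitian_def conj_transpose_simps)
    ultimately show "T Y \<in> S" by (simp add: S_def)
  qed
  moreover have "\<forall>Y\<in>S. \<forall>Z\<in>S. dist (T Y) (T Z) \<le> q * dist Y Z"
  proof safe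
    fix Y Z assume Y: "Y \<in> S" and Z: "Z \<in> S"
    \<comment> \<open>Splitting the difference of squares in this noncommutative way gives the
      Lipschitz constant (q + q) / 2 = q.\<close>
    have "T Y - T Z = (1/2) *\<^sub>R (Y ** (Y - Z) + (Y - Z) ** Z)"
      by (simp add: T_def matrix_ring_simps algebra_simps)
    moreover have "norm (Y ** (Y - Z)) \<le> q * norm (Y - Z)"
      using Y q by (intro norm_matrix_mult_le) (auto simp: S_def)
    moreover have "norm ((Y - Z) ** Z) \<le> q * norm (Y - Z)"
    proof -
      \<comment> \<open>Taking adjoints moves the factor with known operator bound to the left,
        where \<open>norm_matrix_mult_le\<close> applies.\<close>
      have "norm ((Y - Z) ** Z) = norm (Z ** (Y - Z))"
        using Y Z norm_conj_transpose[of "(Y - Z) ** Z"]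
        by (simp add: S_def hermitian_def conj_transpose_simps)
      also have "\<dots> \<le> q * norm (Y - Z)"
        using Z q by (intro norm_matrix_mult_le) (auto simp: S_def)
      finally show ?thesis .
    qed
    ultimately show "dist (T Y) (T Z) \<le> q * dist Y Z"
      using norm_triangle_ineq[of "Y ** (Y - Z)" "(Y - Z) ** Z"] by (simp add: dist_norm)
  qed
  ultimately obtain Y where Y: "Y \<in> S" "T Y = Y"
    using Banach_fix[of S q T] q by blast
  have "2 *\<^sub>R T Y = 2 *\<^sub>R Y" using Y by simp
  then have fix2: "E + Y ** Y = Y + Y" by (simp add: T_def scaleR_2)
  have "(mat 1 - Y) ** (mat 1 - Y) = mat 1 - (Y + Y) + Y ** Y"
    by (simp add: matrix_ring_simps)
  also have "\<dots> = t *\<^sub>R A" unfolding fix2[symmetric] by (simp add: E_def)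
  finally have sq: "(mat 1 - Y) ** (mat 1 - Y) = t *\<^sub>R A" .
  have "0 \<le> x \<bullet> ((mat 1 - Y) *v x)" for x
  proof -
    have "x \<bullet> (Y *v x) \<le> norm x * (q * norm x)"
      using Y by (auto simp: S_def intro!: order_trans[OF norm_cauchy_schwarz] mult_left_mono)
    also have "\<dots> \<le> norm x * (1 * norm x)"
      using q by (intro mult_left_mono mult_right_mono) auto
    finally show ?thesis
      by (simp add: matrix_vector_mult_diff_rdistrib inner_diff_right dot_square_norm power2_eq_square)
  qed
  moreover have "hermitian (mat 1 - Y)"
    using Y by (simp add: S_def hermitian_def conj_transpose_simps)
  ultimately have "pos_semidef ((1 / sqrt t) *\<^sub>R (mat 1 - Y))"
    using t by (auto simp: pos_semidef_inner hermitian_def conj_transpose_simps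
        matrix_vector_mult_scaleR_left)
  moreover have "((1 / sqrt t) *\<^sub>R (mat 1 - Y)) ** ((1 / sqrt t) *\<^sub>R (mat 1 - Y)) = A"
    using t by (simp only: matrix_mult_scaleR_left matrix_mult_scaleR_right sq) simp
  ultimately show ?thesis by blast
qed

text \<open>The form attains a positive minimum on the compact product of \<open>T\<close> with the
  unit sphere, and homogeneity of degree two extends the bound to all vectors. This serves the
  weight on the torus and, with a constant family, single matrices.\<close>

lemma uniformly_coercive:
  fixes F :: "'a::metric_space \<Rightarrow> complex^'n^'n"
  assumes "compact T" "continuous_on T F" "\<And>\<theta>. \<theta> \<in> T \<Longrightarrow> pos_def (F \<theta>)"
  obtains c where "0 < c" "\<And>\<theta> x. \<theta> \<in> T \<Longrightarrow> c * (norm x)\<^sup>2 \<le> x \<bullet> (F \<theta> *v x)"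
proof (cases "T = {}")
  case True
  then show ?thesis using that[of 1] by simp
next
  case False
  define K where "K = T \<times> sphere (0 :: complex^'n) 1"
  define g where "g = (\<lambda>p. snd p \<bullet> (F (fst p) *v snd p))"
  have "compact K" unfolding K_def by (intro compact_Times assms compact_sphere)
  moreover have "K \<noteq> {}" using False by (simp add: K_def)
  moreover have "continuous_on K g"
    unfolding g_def K_def
    by (intro continuous_intros continuous_on_compose2[OF assms(2)]) auto
  ultimately obtain p where p: "p \<in> K" "\<And>y. y \<in> K \<Longrightarrow> g p \<le> g y"
    using continuous_attains_inf by metis
  have "0 < g p"
    using p assms(3)[of "fst p"] by (auto simp: K_def g_def pos_def_inner dest!: spec[of _ "snd p"])
  moreover have "g p * (norm x)\<^sup>2 \<le> x \<bullet> (F \<theta> *v x)" if "\<theta> \<in> T" for \<theta> x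
  proof (cases "x = 0")
    case False
    then have "(\<theta>, (1 / norm x) *\<^sub>R x) \<in> K" using that by (simp add: K_def)
    from p(2)[OF this] False show ?thesis
      by (simp add: g_def matrix_vector_mult_scaleR_right field_simps power2_eq_square)
  qed simp
  ultimately show ?thesis by (rule that)
qed

lemma pos_def_coercive:
  assumes "pos_def A"
  obtains c where "0 < c" "\<And>x. c * (norm x)\<^sup>2 \<le> x \<bullet> (A *v x)"
  by (rule uniformly_coercive[of "{0::real}" "\<lambda>_. A"]) (use assms that in auto)

lemma coercive_imp_pos_def:
  assumes "hermitian A" "0 < c" "\<And>x. c * (norm x)\<^sup>2 \<le> x \<bullet> (A *v x)"
  shows "pos_def A"
  unfolding pos_def_inner using assms
  by (metis mult_pos_pos order_less_le_trans zero_less_norm_iff zero_less_power)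

lemma
  assumes "pos_def A"
  shows pos_semidef_psd_sqrt: "pos_semidef (psd_sqrt A)"
    and psd_sqrt_square: "psd_sqrt A ** psd_sqrt A = A"
proof -
  obtain c where "0 < c" "\<And>x. c * (norm x)\<^sup>2 \<le> x \<bullet> (A *v x)"
    using pos_def_coercive[OF assms] by blast
  then obtain B where "pos_semidef B" "B ** B = A"
    using coercive_has_sqrt assms unfolding pos_def_inner by metis
  then show "pos_semidef (psd_sqrt A)" "psd_sqrt A ** psd_sqrt A = A"
    using psd_sqrt_unique by metis+
qed

lemma conj_transpose_psd_sqrt: "pos_def A \<Longrightarrow> conj_transpose (psd_sqrt A) = psd_sqrt A"
  using pos_semidef_psd_sqrt unfolding pos_semidef_inner hermitian_def by blast

lemma invertible_psd_sqrt:
  assumes "pos_def A" shows "invertible (psd_sqrt A)"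
  using pos_def_invertible[OF assms] psd_sqrt_square[OF assms]
  by (metis invertible_def matrix_left_right_inverse matrix_mul_assoc)

text \<open>The preimage of a closed set \<open>C\<close> is the projection of a closed, hence \<open>\<sigma>\<close>-compact, part of
  the graph.\<close>

lemma borel_measurable_closed_graph:
  fixes f :: "'a::euclidean_space \<Rightarrow> 'b::euclidean_space"
  assumes G: "closed G" and f: "\<And>x y. (x, y) \<in> G \<Longrightarrow> f x = y" and c: "\<And>x. x \<notin> fst ` G \<Longrightarrow> f x = c"
  shows "f \<in> borel_measurable borel"
proof (rule borel_measurableI)
  have proj: "fst ` X \<in> sets borel" if "closed X" for X :: "('a \<times> 'b) set"
  proof -
    have "X = (\<Union>n::nat. X \<inter> cball 0 (real n))"
      by (auto simp: real_arch_simple)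
    then have "fst ` X = (\<Union>n::nat. fst ` (X \<inter> cball 0 (real n)))"
      by (metis image_UN)
    moreover have "fst ` (X \<inter> cball 0 (real n)) \<in> sets borel" for n :: nat
      using that by (intro borel_compact compact_continuous_image closed_Int_compact continuous_intros) auto
    ultimately show ?thesis by auto
  qed
  fix V :: "'b set" assume "open V"
  define C where "C = - V"
  have C: "closed C" using \<open>open V\<close> by (simp add: C_def closed_Compl)
  have "f -` C = fst ` (G \<inter> UNIV \<times> C) \<union> (if c \<in> C then - fst ` G else {})"
    using f c by (force split: if_splits)
  moreover have "closed (G \<inter> UNIV \<times> C)"
    using G C by (intro closed_Int closed_Times) auto
  ultimately have "f -` C \<in> sets borel"
    using proj[of G] proj[of "G \<inter> UNIV \<times> C"] G by (auto intro!: sets.Un borel_comp)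
  then have "- (f -` C) \<in> sets borel" by (rule borel_comp)
  then show "f -` V \<inter> space borel \<in> sets borel" by (simp add: C_def flip: vimage_Compl)
qed

text \<open>Uniqueness of the root makes the closed relation a graph. At matrices without a root the
  predicate under \<open>THE\<close> is constantly false, so all of them share one value.\<close>

lemma borel_measurable_psd_sqrt: "psd_sqrt \<in> borel_measurable (borel :: (complex^'n^'n) measure)"
proof (rule borel_measurable_closed_graph)
  define G where "G = {p :: (complex^'n^'n) \<times> (complex^'n^'n). pos_semidef (snd p) \<and> snd p ** snd p = fst p}"
  have "closed (snd -` {A :: complex^'n^'n. pos_semidef A} :: ((complex^'n^'n) \<times> (complex^'n^'n)) set)"
    by (intro closed_vimage closed_pos_semidef continuous_intros)
  then show "closed G"
    unfolding G_def vimage_def mem_Collect_eq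
    by (intro closed_Collect_conj closed_Collect_eq continuous_intros)
  show "psd_sqrt A = B" if "(A, B) \<in> G" for A B
    using that by (auto simp: G_def intro: psd_sqrt_unique)
  show "psd_sqrt A = (THE B. False)" if "A \<notin> fst ` G" for A
    unfolding psd_sqrt_def using that by (intro arg_cong[where f = The]) (auto simp: G_def image_iff fun_eq_iff)
qed

lemma borel_measurable_matrix_inv: "matrix_inv \<in> borel_measurable (borel :: (complex^'n^'n) measure)"
proof (rule borel_measurable_closed_graph)
  define G where "G = {p :: (complex^'n^'n) \<times> (complex^'n^'n).
    fst p ** snd p = mat 1 \<and> snd p ** fst p = mat 1}"
  show "closed G"
    unfolding G_def by (intro closed_Collect_conj closed_Collect_eq continuous_intros)
  show "matrix_inv A = B" if "(A, B) \<in> G" for A B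
    using that by (auto simp: G_def intro: matrix_inv_unique)
  show "matrix_inv A = (SOME B. False)" if "A \<notin> fst ` G" for A
    unfolding matrix_inv_def using that by (intro arg_cong[where f = Eps]) (auto simp: G_def image_iff fun_eq_iff)
qed

section \<open>Congruences, trace estimates and factorizations of positive matrices\<close>

lemma pos_semidef_add: "pos_semidef A \<Longrightarrow> pos_semidef B \<Longrightarrow> pos_semidef (A + B)"
  by (auto simp: pos_semidef_inner hermitian_def conj_transpose_simps
      matrix_vector_mult_add_rdistrib inner_add_right)

lemma pos_semidef_scaleR: "0 \<le> r \<Longrightarrow> pos_semidef A \<Longrightarrow> pos_semidef (r *\<^sub>R A)"
  by (auto simp: pos_semidef_inner hermitian_def conj_transpose_simps matrix_vector_mult_scaleR_left)

lemma inner_mult_conj_transpose: "x \<bullet> ((A ** conj_transpose A) *v x) = (norm (conj_transpose A *v x))\<^sup>2"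
  by (simp add: inner_matrix_vector power2_norm_eq_inner flip: matrix_vector_mul_assoc)

lemma inner_congruence: "x \<bullet> ((conj_transpose A ** B ** A) *v x) = (A *v x) \<bullet> (B *v (A *v x))"
  by (simp add: inner_matrix_vector[of _ "conj_transpose A"] flip: matrix_vector_mul_assoc)

lemma matrix_inv_cancel:
  assumes "invertible A"
  shows "A ** (matrix_inv A ** X) = X" "matrix_inv A ** (A ** X) = X"
  by (simp_all add: matrix_mul_assoc matrix_inv[OF assms])

lemma pos_def_congruence:
  assumes "pos_def W" "invertible X"
  shows "pos_def (conj_transpose X ** W ** X)"
proof -
  have "X *v x \<noteq> 0" if "x \<noteq> 0" for x
    using that matrix_inv(2)[OF assms(2)]
    by (metis matrix_vector_mul_assoc matrix_vector_mul_lid matrix_vector_mult_0_right)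
  moreover have "hermitian (conj_transpose X ** W ** X)"
    using assms(1) by (simp add: pos_def_inner hermitian_def conj_transpose_mult matrix_mul_assoc)
  ultimately show ?thesis
    using assms(1) by (simp add: pos_def_inner inner_congruence)
qed

lemma trace_conj_transpose: "trace (conj_transpose A) = cnj (trace A)"
  by (simp add: trace_def conj_transpose_def)

lemma pos_semidef_trace:
  assumes "pos_semidef A" shows "trace A = complex_of_real (Re (trace A))" "0 \<le> Re (trace A)"
proof -
  have "cnj (trace A) = trace A"
    using assms by (simp add: pos_semidef_inner hermitian_def flip: trace_conj_transpose)
  then show "trace A = complex_of_real (Re (trace A))" by (metis Reals_cnj_iff of_real_Re)
  have "0 \<le> Re (A $ i $ i)" for i
    using assms unfolding inner_axis_matrix_axis[symmetric] by (simp add: pos_semidef_inner)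
  then show "0 \<le> Re (trace A)" by (simp add: trace_def sum_nonneg)
qed

lemma power2_weighted_norm:
  assumes "pos_semidef W"
  shows "complex_of_real ((weighted_norm W A)\<^sup>2) = trace (conj_transpose A ** W ** A)"
  using pos_semidef_trace[OF pos_semidef_conj[OF assms, of A]] by (simp add: weighted_norm_def)

text \<open>For Hermitian \<open>S\<close> the squared Frobenius norm is the trace of S^2. The bound
  later makes the integrand of the distance integrable.\<close>

lemma power2_norm_pos_semidef_root:
  assumes "pos_semidef S" "S ** S = A"
  shows "(norm S)\<^sup>2 \<le> CARD('n) * norm (A :: complex^'n^'n)"
proof -
  have "(norm S)\<^sup>2 = Re (trace A)"
    using assms Re_trace_mult_conj_transpose[of S] by (simp add: pos_semidef_inner hermitian_def)
  also have "\<dots> \<le> norm (trace A)" by (rule complex_Re_le_cmod)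
  also have "\<dots> \<le> CARD('n) * norm A" by (rule norm_trace_le)
  finally show ?thesis .
qed

text \<open>The norm is at most the squared norm of the square root, that is the trace, and the
  trace sums the values of the form at the unit coordinate vectors.\<close>

lemma norm_le_of_loewner_le:
  fixes A :: "complex^'n^'n" and C :: real
  assumes A: "pos_def A" and C: "\<And>x. x \<bullet> (A *v x) \<le> C * (norm x)\<^sup>2"
  shows "norm A \<le> CARD('n) * C"
proof -
  let ?S = "psd_sqrt A"
  have S: "?S ** ?S = A" "conj_transpose ?S = ?S"
    using A by (simp_all add: psd_sqrt_square conj_transpose_psd_sqrt)
  have "norm A \<le> norm ?S * norm ?S"
    using norm_matrix_mult[of ?S ?S] by (simp add: S)
  also have "\<dots> = Re (trace A)"
    using Re_trace_mult_conj_transpose[of ?S] by (simp add: S power2_eq_square)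
  also have "\<dots> = (\<Sum>i\<in>UNIV. axis i 1 \<bullet> (A *v axis i 1))"
    by (simp only: trace_def inner_axis_matrix_axis Re_sum)
  also have "\<dots> \<le> (\<Sum>i\<in>(UNIV::'n set). C * (norm (axis i (1::complex) :: complex^'n))\<^sup>2)"
    by (intro sum_mono C)
  finally show ?thesis by simp
qed

text \<open>If \<open>S = (F F\<^sup>*)\<^sup>1\<^sup>/\<^sup>2\<close>, then \<open>V = S\<^sup>-\<^sup>1 F\<close> is unitary and \<open>S W G = V F\<^sup>* W G\<close>.\<close>

lemma psd_sqrt_factorization:
  fixes F G W :: "complex^'n^'n"
  assumes pd: "pos_def (F ** conj_transpose F)" and ps: "pos_semidef (conj_transpose F ** W ** G)"
    and W: "hermitian W"
  defines "S \<equiv> psd_sqrt (F ** conj_transpose F)"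
  defines "R \<equiv> psd_sqrt (S ** W ** (G ** conj_transpose G) ** W ** S)"
  shows "pos_semidef R" "R ** R = S ** W ** (G ** conj_transpose G) ** W ** S"
    "trace R = trace (conj_transpose F ** W ** G)"
proof -
  have S: "S ** S = F ** conj_transpose F" "conj_transpose S = S" "invertible S"
    unfolding S_def
    by (simp_all add: psd_sqrt_square[OF pd] conj_transpose_psd_sqrt[OF pd] invertible_psd_sqrt[OF pd])
  define V where "V = matrix_inv S ** F"
  define N where "N = conj_transpose F ** W ** G"
  have iS: "conj_transpose (matrix_inv S) = matrix_inv S"
    using S by (simp add: conj_transpose_matrix_inv)
  have "V ** conj_transpose V = matrix_inv S ** (F ** conj_transpose F) ** matrix_inv S"
    by (simp add: V_def conj_transpose_mult iS matrix_mul_assoc)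
  also have "\<dots> = mat 1"
    by (simp add: matrix_inv_cancel[OF S(3)] matrix_inv[OF S(3)] flip: S(1) matrix_mul_assoc)
  finally have "V ** conj_transpose V = mat 1" .
  then have VV: "conj_transpose V ** V = mat 1" by (simp add: matrix_left_right_inverse)
  have "S ** V = F" by (simp add: V_def matrix_inv_cancel[OF S(3)])
  then have F: "conj_transpose F = conj_transpose V ** S"
    using S(2) by (metis conj_transpose_mult)
  have hN: "conj_transpose N = N" using ps by (simp add: N_def pos_semidef_inner hermitian_def)
  have "V ** N = S ** W ** G"
    using \<open>V ** conj_transpose V = mat 1\<close> by (simp add: N_def F matrix_mul_assoc)
  then have "(V ** N) ** conj_transpose (V ** N) = S ** W ** (G ** conj_transpose G) ** W ** S"
    using W S(2) by (simp add: conj_transpose_mult hermitian_def matrix_mul_assoc)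
  moreover have "(V ** N ** conj_transpose V) ** (V ** N ** conj_transpose V)
      = V ** N ** (conj_transpose V ** V) ** N ** conj_transpose V"
    by (simp add: matrix_mul_assoc)
  ultimately have sq: "(V ** N ** conj_transpose V) ** (V ** N ** conj_transpose V)
      = S ** W ** (G ** conj_transpose G) ** W ** S"
    by (simp add: VV hN conj_transpose_mult matrix_mul_assoc)
  \<comment> \<open>Conjugating \<open>N\<close> by the unitary \<open>V\<close> keeps positivity
    and trace, and the square of the result is the argument of the root; uniqueness then identifies
    it with \<open>R\<close>.\<close>
  have psV: "pos_semidef (V ** N ** conj_transpose V)"
    using pos_semidef_conj[of N "conj_transpose V"] ps by (simp add: N_def)
  have R: "R = V ** N ** conj_transpose V"
    unfolding R_def by (rule psd_sqrt_unique[OF psV sq])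
  show "pos_semidef R" "R ** R = S ** W ** (G ** conj_transpose G) ** W ** S"
    unfolding R by (rule psV sq)+
  have "trace R = trace (conj_transpose V ** (V ** N))"
    unfolding R by (rule trace_mul_sym)
  then show "trace R = trace (conj_transpose F ** W ** G)"
    by (simp add: matrix_mul_assoc VV N_def)
qed

text \<open>Both cross terms in the expansion of the weighted square equal F^* W G, because that
  matrix is Hermitian, and its trace is the trace of the root. Cyclicity of the trace matches the
  remaining terms.\<close>

lemma trace_hellinger_integrand:
  fixes F G W :: "complex^'n^'n"
  assumes pd: "pos_def (F ** conj_transpose F)" and ps: "pos_semidef (conj_transpose F ** W ** G)"
    and W: "pos_semidef W"
  defines "S \<equiv> psd_sqrt (F ** conj_transpose F)"
  shows "trace (W ** (F ** conj_transpose F) + W ** (G ** conj_transpose G)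
      - 2 *\<^sub>R psd_sqrt (S ** W ** (G ** conj_transpose G) ** W ** S))
    = complex_of_real ((weighted_norm W (F - G))\<^sup>2)"
proof -
  let ?N = "conj_transpose F ** W ** G"
  have W': "conj_transpose W = W" using W by (simp add: pos_semidef_inner hermitian_def)
  have cyc: "trace (W ** (X ** conj_transpose X)) = trace (conj_transpose X ** W ** X)" for X
    by (metis matrix_mul_assoc trace_mul_sym)
  have "conj_transpose ?N = ?N"
    using ps by (simp add: pos_semidef_inner hermitian_def)
  then have GF: "conj_transpose G ** W ** F = ?N"
    by (simp add: conj_transpose_mult W' matrix_mul_assoc)
  have "trace (conj_transpose (F - G) ** W ** (F - G))
    = trace (conj_transpose F ** W ** F) + trace (conj_transpose G ** W ** G)
      - (trace ?N + trace ?N)"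
    by (simp only: conj_transpose_diff matrix_diff_ldistrib matrix_diff_rdistrib trace_sub GF) simp
  then show ?thesis
    using psd_sqrt_factorization(3)[OF pd ps, folded S_def] W
    unfolding power2_weighted_norm[OF W] trace_sub trace_add trace_scaleR cyc
    by (simp add: pos_semidef_inner scaleR_conv_of_real)
qed

subsection \<open>The path at a fixed frequency\<close>

text \<open>\<open>P\<close>, \<open>Q\<close> and \<open>W\<close> are the values of the two
  densities and of the weight at one frequency. The locale collects the linear algebra of the path;
  it is interpreted at almost every frequency.\<close>

locale density_pair =
  fixes P Q W :: "complex^'m^'m"
  assumes P: "pos_def P" and Q: "pos_def Q" and W: "pos_def W"
begin

definition "A = psd_sqrt P"
definition "B = psd_sqrt Q"
definition "M = psd_sqrt (A ** W ** Q ** W ** A)"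
definition "U = matrix_inv B ** matrix_inv W ** matrix_inv A ** M"
definition "F \<tau> = (1 - \<tau>) *\<^sub>R A + \<tau> *\<^sub>R (B ** U)"

lemma A: "A ** A = P" "conj_transpose A = A" "invertible A"
  unfolding A_def by (simp_all add: P psd_sqrt_square conj_transpose_psd_sqrt invertible_psd_sqrt)

lemma B: "B ** B = Q" "conj_transpose B = B" "invertible B"
  unfolding B_def by (simp_all add: Q psd_sqrt_square conj_transpose_psd_sqrt invertible_psd_sqrt)

lemma W': "conj_transpose W = W" "invertible W"
  using W pos_def_invertible by (auto simp: pos_def_inner hermitian_def)

lemma M: "M ** M = A ** W ** Q ** W ** A" "conj_transpose M = M" "pos_semidef M"
proof -
  have "pos_def (conj_transpose A ** (conj_transpose W ** Q ** W) ** A)"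
    by (intro pos_def_congruence Q A W')
  then have pd: "pos_def (A ** W ** Q ** W ** A)"
    by (simp add: A W' matrix_mul_assoc)
  show "M ** M = A ** W ** Q ** W ** A" "conj_transpose M = M" "pos_semidef M"
    unfolding M_def
    by (simp_all add: pd psd_sqrt_square conj_transpose_psd_sqrt pos_semidef_psd_sqrt)
qed

lemma U_unitary: "U ** conj_transpose U = mat 1"
proof -
  have ct: "conj_transpose (matrix_inv A) = matrix_inv A" "conj_transpose (matrix_inv B) = matrix_inv B"
    "conj_transpose (matrix_inv W) = matrix_inv W"
    using A B W' by (simp_all add: conj_transpose_matrix_inv)
  \<comment> \<open>Splitting \<open>Q\<close> as \<open>B ** B\<close> exhibits M^2 as A W B times
    its adjoint, which the inverses cancel from both sides.\<close>
  have MM: "M ** M = A ** W ** (B ** B) ** W ** A" by (simp only: M(1) B(1))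
  have "U ** conj_transpose U = matrix_inv B ** matrix_inv W ** matrix_inv A ** (M ** M)
      ** matrix_inv A ** matrix_inv W ** matrix_inv B"
    by (simp add: U_def conj_transpose_mult ct M(2) matrix_mul_assoc)
  also have "\<dots> = mat 1"
    unfolding MM using A(3) B(3) W'(2)
    by (simp add: matrix_inv_cancel matrix_inv flip: matrix_mul_assoc)
  finally show ?thesis .
qed

lemma U_unitary': "conj_transpose U ** U = mat 1"
  using U_unitary by (simp add: matrix_left_right_inverse)

lemma norm_U: "norm (U *v x) = norm x" "norm (conj_transpose U *v x) = norm x"
proof -
  have "(norm (U *v x))\<^sup>2 = (norm x)\<^sup>2" "(norm (conj_transpose U *v x))\<^sup>2 = (norm x)\<^sup>2"
    using inner_mult_conj_transpose[of x "conj_transpose U"] inner_mult_conj_transpose[of x U]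
    by (simp_all add: U_unitary U_unitary' power2_norm_eq_inner)
  then show "norm (U *v x) = norm x" "norm (conj_transpose U *v x) = norm x" by simp_all
qed

lemma AWBU: "A ** W ** (B ** U) = M"
  unfolding U_def using A(3) B(3) W'(2)
  by (simp add: matrix_inv_cancel flip: matrix_mul_assoc)

lemma F_0: "F 0 ** conj_transpose (F 0) = P"
  by (simp add: F_def A)

lemma F_1: "F 1 ** conj_transpose (F 1) = Q"
proof -
  have "F 1 ** conj_transpose (F 1) = B ** (U ** conj_transpose U) ** B"
    by (simp add: F_def conj_transpose_mult B matrix_mul_assoc)
  then show ?thesis by (simp add: U_unitary B)
qed

text \<open>The two mixed terms are adjoint to each other, and one of them is the Hermitian matrix
  \<open>M\<close>; hence they merge into one.\<close>

lemma conj_transpose_F_W_F: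
  "conj_transpose (F \<sigma>) ** W ** F \<tau> = ((1 - \<sigma>) * (1 - \<tau>)) *\<^sub>R (conj_transpose A ** W ** A)
    + ((1 - \<sigma>) * \<tau> + \<sigma> * (1 - \<tau>)) *\<^sub>R M
    + (\<sigma> * \<tau>) *\<^sub>R (conj_transpose (B ** U) ** W ** (B ** U))"
proof -
  have "conj_transpose (B ** U) ** W ** A = conj_transpose (A ** W ** (B ** U))"
    by (simp add: conj_transpose_mult A W' matrix_mul_assoc)
  then have "conj_transpose (B ** U) ** W ** A = M" unfolding AWBU by (simp add: M)
  then show ?thesis
    using AWBU by (simp add: F_def conj_transpose_add conj_transpose_scaleR matrix_add_ldistrib
        matrix_add_rdistrib matrix_mult_scaleR_left matrix_mult_scaleR_right A scaleR_add_left
        scaleR_add_right mult.commute)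
qed

lemma pos_semidef_F_W_F:
  assumes "\<sigma> \<in> {0..1}" "\<tau> \<in> {0..1}"
  shows "pos_semidef (conj_transpose (F \<sigma>) ** W ** F \<tau>)"
  unfolding conj_transpose_F_W_F using assms pos_def_imp_pos_semidef[OF W]
  by (intro pos_semidef_add pos_semidef_scaleR pos_semidef_conj M) auto

text \<open>The adjoint of \<open>F \<tau>\<close> is a convex combination of \<open>A\<close> and
  U^* B. Both have operator norm at most \<open>sqrt C\<close>, as U^* is an isometry.\<close>

lemma F_upper:
  assumes \<tau>: "\<tau> \<in> {0..1}" and C: "0 \<le> C"
    "\<And>x. x \<bullet> (P *v x) \<le> C * (norm x)\<^sup>2" "\<And>x. x \<bullet> (Q *v x) \<le> C * (norm x)\<^sup>2"
  shows "x \<bullet> ((F \<tau> ** conj_transpose (F \<tau>)) *v x) \<le> C * (norm x)\<^sup>2"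
proof -
  have "(norm (A *v x))\<^sup>2 \<le> (sqrt C * norm x)\<^sup>2" "(norm (B *v x))\<^sup>2 \<le> (sqrt C * norm x)\<^sup>2"
    using C(1) C(2,3)[of x] inner_mult_conj_transpose[of x A] inner_mult_conj_transpose[of x B]
    by (auto simp: A B power_mult_distrib)
  then have AB: "norm (A *v x) \<le> sqrt C * norm x" "norm (B *v x) \<le> sqrt C * norm x"
    using C by (auto intro: power2_le_imp_le)
  have "norm (conj_transpose (F \<tau>) *v x)
      = norm ((1 - \<tau>) *\<^sub>R (A *v x) + \<tau> *\<^sub>R (conj_transpose U *v (B *v x)))"
    by (simp add: F_def conj_transpose_simps A B matrix_vector_mult_add_rdistrib
        matrix_vector_mult_scaleR_left matrix_vector_mul_assoc)
  also have "\<dots> \<le> (1 - \<tau>) * norm (A *v x) + \<tau> * norm (B *v x)"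
    using \<tau> by (intro norm_triangle_le) (simp add: norm_U)
  also have "\<dots> \<le> (1 - \<tau>) * (sqrt C * norm x) + \<tau> * (sqrt C * norm x)"
    using \<tau> AB by (intro add_mono mult_left_mono) auto
  also have "\<dots> = sqrt C * norm x" by (simp add: algebra_simps)
  finally have "(norm (conj_transpose (F \<tau>) *v x))\<^sup>2 \<le> (sqrt C * norm x)\<^sup>2"
    by (intro power_mono) auto
  then show ?thesis
    using C by (simp add: inner_mult_conj_transpose power_mult_distrib)
qed

lemma F_lower:
  assumes \<tau>: "\<tau> \<in> {0..1}" and c: "0 < c" "0 < w" "0 < w'"
    "\<And>x. c * (norm x)\<^sup>2 \<le> x \<bullet> (P *v x)" "\<And>x. c * (norm x)\<^sup>2 \<le> x \<bullet> (Q *v x)"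
    "\<And>x. w * (norm x)\<^sup>2 \<le> x \<bullet> (W *v x)" "norm W \<le> w'"
  shows "w * c / (2 * w') * (norm y)\<^sup>2 \<le> y \<bullet> ((F \<tau> ** conj_transpose (F \<tau>)) *v y)"
proof -
  define k where "k = w * c / (2 * w')"
  have k: "0 < k" using c by (simp add: k_def)
  have F: "k * (norm x)\<^sup>2 \<le> (norm (F \<tau> *v x))\<^sup>2" for x
  proof -
    have "w * (c * (norm x)\<^sup>2) \<le> w * (norm (A *v x))\<^sup>2"
      using c(2) c(4)[of x] inner_mult_conj_transpose[of x A] by (intro mult_left_mono) (auto simp: A)
    also have "\<dots> \<le> (A *v x) \<bullet> (W *v (A *v x))" by (rule c)
    finally have 1: "w * c * (norm x)\<^sup>2 \<le> x \<bullet> ((conj_transpose A ** W ** A) *v x)"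
      by (simp add: inner_congruence mult.assoc)
    have "w * (c * (norm (U *v x))\<^sup>2) \<le> w * (norm (B *v (U *v x)))\<^sup>2"
      using c(2) c(5)[of "U *v x"] inner_mult_conj_transpose[of "U *v x" B] by (intro mult_left_mono) (auto simp: B)
    also have "\<dots> \<le> (B *v (U *v x)) \<bullet> (W *v (B *v (U *v x)))" by (rule c)
    finally have 2: "w * c * (norm x)\<^sup>2 \<le> x \<bullet> ((conj_transpose (B ** U) ** W ** (B ** U)) *v x)"
      unfolding inner_congruence by (simp add: norm_U matrix_vector_mul_assoc mult.assoc)
    have 3: "0 \<le> x \<bullet> (M *v x)" using M(3) by (simp add: pos_semidef_inner)
    \<comment> \<open>Equivalent to (1 - 2 \<tau>)^2 \<ge> 0, with equality at the midpoint of the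
      path.\<close>
    have half: "1 / 2 \<le> (1 - \<tau>)\<^sup>2 + \<tau>\<^sup>2"
      using zero_le_power2[of "1 - 2 * \<tau>"] by (simp add: power2_eq_square algebra_simps)
    have "w * c * (norm x)\<^sup>2 * (1 / 2) \<le> w * c * (norm x)\<^sup>2 * ((1 - \<tau>)\<^sup>2 + \<tau>\<^sup>2)"
      using c half by (intro mult_left_mono) auto
    also have "\<dots> = (1 - \<tau>)\<^sup>2 * (w * c * (norm x)\<^sup>2) + \<tau>\<^sup>2 * (w * c * (norm x)\<^sup>2)"
      by (simp add: algebra_simps)
    also have "\<dots> \<le> (1 - \<tau>)\<^sup>2 * (x \<bullet> ((conj_transpose A ** W ** A) *v x))
        + \<tau>\<^sup>2 * (x \<bullet> ((conj_transpose (B ** U) ** W ** (B ** U)) *v x))"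
      by (intro add_mono mult_left_mono 1 2) auto
    also have "\<dots> \<le> x \<bullet> ((conj_transpose (F \<tau>) ** W ** F \<tau>) *v x)"
      using \<tau> 3 unfolding conj_transpose_F_W_F
      by (simp add: matrix_vector_mult_add_rdistrib matrix_vector_mult_scaleR_left inner_add_right
          power2_eq_square)
    also have "\<dots> = (F \<tau> *v x) \<bullet> (W *v (F \<tau> *v x))" by (rule inner_congruence)
    also have "\<dots> \<le> norm (F \<tau> *v x) * (norm W * norm (F \<tau> *v x))"
      by (intro order_trans[OF norm_cauchy_schwarz] mult_left_mono norm_matrix_vector_mult) auto
    also have "\<dots> \<le> norm (F \<tau> *v x) * (w' * norm (F \<tau> *v x))"
      using c by (intro mult_left_mono mult_right_mono) auto
    finally show ?thesis
      using c by (simp add: k_def field_simps power2_eq_square)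
  qed
  have "F \<tau> *v x = 0 \<Longrightarrow> x = 0" for x
    using F[of x] k by (simp add: mult_le_0_iff)
  then obtain G where "G ** F \<tau> = mat 1"
    using matrix_left_invertible_ker[of "F \<tau>"] by blast
  then have "F \<tau> ** G = mat 1" by (simp add: matrix_left_right_inverse)
  then obtain z where z: "y = F \<tau> *v z"
    by (metis matrix_vector_mul_assoc matrix_vector_mul_lid)
  \<comment> \<open>The lower bound for \<open>F \<tau>\<close> passes to its adjoint, since \<open>\<parallel>y\<parallel>\<^sup>2 = \<langle>(F \<tau>)\<^sup>* y, z\<rangle>\<close> for \<open>y = (F \<tau>) z\<close>.\<close>
  have "k * (norm y)\<^sup>2 \<le> (norm (conj_transpose (F \<tau>) *v y))\<^sup>2"
  proof (cases "y = 0")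
    case False
    have "(norm y)\<^sup>2 = (conj_transpose (F \<tau>) *v y) \<bullet> z"
      by (simp add: power2_norm_eq_inner flip: inner_matrix_vector z)
    also have "\<dots> \<le> norm (conj_transpose (F \<tau>) *v y) * norm z"
      by (rule norm_cauchy_schwarz)
    finally have "((norm y)\<^sup>2)\<^sup>2 \<le> (norm (conj_transpose (F \<tau>) *v y) * norm z)\<^sup>2"
      by (intro power_mono) auto
    then have "k * ((norm y)\<^sup>2)\<^sup>2 \<le> (norm (conj_transpose (F \<tau>) *v y))\<^sup>2 * (k * (norm z)\<^sup>2)"
      using k by (simp add: power_mult_distrib mult.left_commute)
    also have "\<dots> \<le> (norm (conj_transpose (F \<tau>) *v y))\<^sup>2 * (norm y)\<^sup>2"
      using F[of z] by (intro mult_left_mono) (auto simp: z)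
    finally have "k * (norm y)\<^sup>2 * (norm y)\<^sup>2 \<le> (norm (conj_transpose (F \<tau>) *v y))\<^sup>2 * (norm y)\<^sup>2"
      by (simp add: power2_eq_square mult.assoc)
    then show ?thesis using False by simp
  qed simp
  then show ?thesis by (simp add: inner_mult_conj_transpose k_def)
qed

end

subsection \<open>Entrywise conjugation\<close>

text \<open>Conjugation without transposition preserves the order of products, so that it commutes
  with every operation from which the path is built.\<close>

definition conj_mat :: "complex^'n^'m \<Rightarrow> complex^'n^'m"
  where "conj_mat A = (\<chi> i j. cnj (A $ i $ j))"

lemma conj_mat_simps:
  "conj_mat (A ** B) = conj_mat A ** conj_mat B"
  "conj_mat (A + C) = conj_mat A + conj_mat C"
  "conj_mat (r *\<^sub>R A) = r *\<^sub>R conj_mat A"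
  "conj_mat (conj_transpose A) = conj_transpose (conj_mat A)"
  "conj_mat (mat 1) = mat 1"
  by (auto simp: conj_mat_def conj_transpose_def vec_eq_iff matrix_matrix_mult_def mat_def)

lemma pos_semidef_conj_mat:
  assumes "pos_semidef A" shows "pos_semidef (conj_mat A)"
proof -
  have "quad_form (conj_mat A) x = cnj (quad_form A (\<chi> i. cnj (x $ i)))" for x
    by (simp add: quad_form_def conj_mat_def matrix_vector_mult_def)
  moreover have "hermitian (conj_mat A)"
    using assms unfolding pos_semidef_def hermitian_def by (metis conj_mat_simps(4))
  ultimately show ?thesis using assms by (simp add: pos_semidef_def)
qed

lemma psd_sqrt_conj_mat:
  assumes "pos_def A" shows "psd_sqrt (conj_mat A) = conj_mat (psd_sqrt A)"
  using assms by (intro psd_sqrt_unique pos_semidef_conj_mat pos_semidef_psd_sqrt)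
    (simp_all add: psd_sqrt_square flip: conj_mat_simps(1))

lemma matrix_inv_conj_mat:
  assumes "invertible A" shows "matrix_inv (conj_mat A) = conj_mat (matrix_inv A)"
  using assms by (intro matrix_inv_unique) (simp_all add: matrix_inv conj_mat_simps(5) flip: conj_mat_simps(1))

lemma pos_def_conj_mat:
  assumes "pos_def A" shows "pos_def (conj_mat A)"
proof -
  have "quad_form (conj_mat A) x = cnj (quad_form A (\<chi> i. cnj (x $ i)))" for x
    by (simp add: quad_form_def conj_mat_def matrix_vector_mult_def)
  moreover have "hermitian (conj_mat A)"
    using assms unfolding pos_def_def hermitian_def by (metis conj_mat_simps(4))
  moreover have "(\<chi> i. cnj (x $ i)) \<noteq> 0" if "x \<noteq> 0" for x :: "complex^'n"
    using that by (simp add: vec_eq_iff)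
  ultimately show ?thesis using assms by (simp add: pos_def_def) blast
qed

context density_pair
begin

text \<open>Square roots commute with conjugation by their uniqueness, inverses likewise, and
  products and sums do so entrywise.\<close>

lemma F_conj_mat: "density_pair.F (conj_mat P) (conj_mat Q) (conj_mat W) \<tau> = conj_mat (F \<tau>)"
proof -
  interpret c: density_pair "conj_mat P" "conj_mat Q" "conj_mat W"
    by unfold_locales (intro pos_def_conj_mat P Q W)+
  have A': "c.A = conj_mat A" and B': "c.B = conj_mat B"
    unfolding c.A_def c.B_def A_def B_def by (simp_all add: psd_sqrt_conj_mat P Q)
  have "c.M = conj_mat M"
    unfolding c.M_def A'
    by (intro psd_sqrt_unique pos_semidef_conj_mat M) (simp add: M flip: conj_mat_simps(1))
  then show ?thesis
    unfolding c.F_def F_def c.U_def U_def A' B'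
    by (simp add: conj_mat_simps matrix_inv_conj_mat A B W')
qed

end

subsection \<open>The torus\<close>

lemma sets_lebesgue_torus [simp]: "torus \<in> sets lebesgue"
  by (simp add: torus_def)

lemma space_torus_measure [simp]: "space torus_measure = torus"
  by (simp add: torus_measure_def)

lemma sets_torus_measure: "sets torus_measure = sets (lebesgue_on torus)"
  by (simp add: torus_measure_def)

lemma sets_torus_measure_iff: "A \<in> sets torus_measure \<longleftrightarrow> A \<subseteq> torus \<and> A \<in> sets lebesgue"
  by (simp add: sets_torus_measure sets_restrict_space_iff)

lemma emeasure_torus_measure:
  "A \<in> sets torus_measure \<Longrightarrow>
    emeasure (torus_measure :: (real^'d) measure) A = ennreal (1 / (2 * pi) ^ CARD('d)) * emeasure lebesgue A"
  unfolding torus_measure_def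
  by (subst emeasure_density_const) (auto simp: emeasure_restrict_space sets_restrict_space)

lemma AE_torus_measure: "(AE \<theta> in torus_measure. P \<theta>) \<longleftrightarrow> (AE \<theta> in lebesgue. \<theta> \<in> torus \<longrightarrow> P \<theta>)"
  unfolding torus_measure_def
  by (subst AE_density) (auto simp: AE_restrict_space_iff ennreal_zero_less_mult_iff)

lemma emeasure_lebesgue_torus_finite: "emeasure lebesgue (torus :: (real^'d) set) \<noteq> \<infinity>"
  using fmeasurableD2[of "torus :: (real^'d) set" lebesgue] by (simp add: torus_def)

interpretation torus_measure: finite_measure torus_measure
proof
  show "emeasure (torus_measure :: (real^'d) measure) (space torus_measure) \<noteq> \<infinity>"
    using emeasure_lebesgue_torus_finite[where 'd = 'd]
    by (simp add: emeasure_torus_measure sets_torus_measure_iff ennreal_mult_eq_top_iff)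
qed

lemma continuous_on_borel_measurable_torus:
  fixes f :: "real^'d \<Rightarrow> 'a::euclidean_space"
  assumes "continuous_on torus f" shows "f \<in> borel_measurable torus_measure"
  using continuous_imp_measurable_on_sets_lebesgue[OF assms]
  by (simp add: measurable_cong_sets[OF sets_torus_measure refl])

lemma compact_torus: "compact torus"
  by (simp add: torus_def compact_cbox)

lemma mem_torus: "\<theta> \<in> torus \<longleftrightarrow> (\<forall>k. 0 \<le> \<theta> $ k \<and> \<theta> $ k \<le> 2 * pi)"
  by (simp add: torus_def mem_box_cart)

text \<open>The representative of -\<theta> modulo the period that stays in the cube; characters
  turn into their conjugates.\<close>

definition torus_reflect :: "real^'d \<Rightarrow> real^'d"
  where "torus_reflect \<theta> = (\<chi> k. 2 * pi) - \<theta>"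

lemma torus_reflect_mem [simp]: "torus_reflect \<theta> \<in> torus \<longleftrightarrow> \<theta> \<in> torus"
  by (auto simp: mem_torus torus_reflect_def)

text \<open>The reflection is affine with factor -1 in each coordinate, hence preserves Lebesgue
  measure, and it maps the cube onto itself.\<close>

lemma
  shows torus_reflect_measurable: "torus_reflect \<in> torus_measure \<rightarrow>\<^sub>M (torus_measure :: (real^'d) measure)"
    and distr_torus_reflect: "distr torus_measure torus_measure torus_reflect = (torus_measure :: (real^'d) measure)"
proof -
  have T: "torus_reflect = (\<lambda>x :: real^'d. (\<chi> k. 2 * pi) + (\<Sum>j\<in>Basis. (- 1 * (x \<bullet> j)) *\<^sub>R j))"
    by (simp add: fun_eq_iff torus_reflect_def sum_negf euclidean_representation)
  have meas: "torus_reflect \<in> lebesgue \<rightarrow>\<^sub>M (lebesgue :: (real^'d) measure)"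
    unfolding T by (rule lebesgue_affine_measurable) auto
  have leb: "distr lebesgue lebesgue torus_reflect = (lebesgue :: (real^'d) measure)"
    unfolding T by (subst (3) lebesgue_affine_euclidean[where c = "\<lambda>_. -1" and t = "\<chi> k. 2 * pi"])
      (auto simp: density_1)
  have vim: "torus_reflect -` A \<inter> torus = torus_reflect -` A" if "A \<subseteq> torus" for A :: "(real^'d) set"
    using that torus_reflect_mem by blast
  have sub: "A \<in> sets torus_measure \<Longrightarrow> A \<in> sets lebesgue \<and> A \<subseteq> torus" for A :: "(real^'d) set"
    by (simp add: sets_torus_measure_iff)
  have vs: "torus_reflect -` A \<in> sets lebesgue" if "A \<in> sets lebesgue" for A :: "(real^'d) set"
    using measurable_sets[OF meas that] by simp
  show m: "torus_reflect \<in> torus_measure \<rightarrow>\<^sub>M (torus_measure :: (real^'d) measure)"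
  proof (rule measurableI)
    fix A :: "(real^'d) set" assume "A \<in> sets torus_measure"
    then have "A \<in> sets lebesgue" "A \<subseteq> torus" using sub by blast+
    then show "torus_reflect -` A \<inter> space torus_measure \<in> sets torus_measure"
      unfolding sets_torus_measure_iff space_torus_measure using vs by (simp add: vim) (metis vim inf_le2)
  qed simp
  show "distr torus_measure torus_measure torus_reflect = (torus_measure :: (real^'d) measure)"
  proof (rule measure_eqI)
    fix A :: "(real^'d) set" assume "A \<in> sets (distr torus_measure torus_measure torus_reflect)"
    then have A: "A \<in> sets torus_measure" by simp
    have "emeasure lebesgue (torus_reflect -` A) = emeasure lebesgue A"
      using sub[OF A] by (subst (2) leb[symmetric]) (simp add: emeasure_distr meas)
    then show "emeasure (distr torus_measure torus_measure torus_reflect) A = emeasure torus_measure A"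
      using measurable_sets[OF m A] A sub[OF A]
      by (simp add: emeasure_distr m vim emeasure_torus_measure)
  qed simp
qed

lemma AE_torus_reflect: "(AE \<theta> in torus_measure. P \<theta>) \<Longrightarrow> AE \<theta> in torus_measure. P (torus_reflect \<theta>)"
  using AE_distrD[OF torus_reflect_measurable, of P] unfolding distr_torus_reflect .

lemma integral_torus_reflect:
  fixes f :: "real^'d \<Rightarrow> 'a::{banach, second_countable_topology}"
  assumes "f \<in> borel_measurable torus_measure"
  shows "(\<integral>\<theta>. f (torus_reflect \<theta>) \<partial>torus_measure) = (\<integral>\<theta>. f \<theta> \<partial>torus_measure)"
  using integral_distr[OF torus_reflect_measurable assms] by (simp add: distr_torus_reflect)

lemma integrable_torus_reflect:
  fixes f :: "real^'d \<Rightarrow> 'a::{banach, second_countable_topology}"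
  assumes "integrable torus_measure f"
  shows "integrable torus_measure (\<lambda>\<theta>. f (torus_reflect \<theta>))"
  using integrable_distr[OF torus_reflect_measurable, of f] assms by (simp add: distr_torus_reflect)

subsection \<open>Characters and Fourier coefficients\<close>

lemma pairing_add_right: "pairing \<theta> (s + t) = pairing \<theta> s + pairing \<theta> t"
  by (simp add: pairing_def algebra_simps sum.distrib)

lemma pairing_minus_right: "pairing \<theta> (- t) = - pairing \<theta> t"
  by (simp add: pairing_def sum_negf)

lemma pairing_axis: "pairing \<theta> (axis k n) = of_int n * \<theta> $ k"
  by (simp add: pairing_def axis_def if_distrib mult.commute cong: if_cong)

lemma continuous_on_pairing [continuous_intros]:
  "continuous_on S f \<Longrightarrow> continuous_on S (\<lambda>x. pairing (f x) t)"
  unfolding pairing_def by (intro continuous_intros)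

lemma cis_pairing_reflect: "cis (pairing (torus_reflect \<theta>) t) = cis (- pairing \<theta> t)"
proof -
  have "pairing (torus_reflect \<theta>) t = 2 * pi * of_int (\<Sum>k\<in>UNIV. t $ k) + - pairing \<theta> t"
    by (simp add: pairing_def torus_reflect_def algebra_simps sum_subtractf sum_distrib_left)
  also have "cis \<dots> = cis (2 * pi * of_int (\<Sum>k\<in>UNIV. t $ k)) * cis (- pairing \<theta> t)"
    by (rule cis_mult[symmetric])
  also have "\<dots> = cis (- pairing \<theta> t)"
    by (simp only: cis_multiple_2pi[OF Ints_of_int] mult_1)
  finally show ?thesis .
qed

lemma integrable_cis_pairing_mult:
  assumes "integrable torus_measure g"
  shows "integrable torus_measure (\<lambda>\<theta>. cis (pairing \<theta> t) * g \<theta>)"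
proof (rule Bochner_Integration.integrable_bound[OF assms])
  have "(\<lambda>\<theta>. cis (pairing \<theta> t)) \<in> borel_measurable torus_measure"
    by (intro continuous_on_borel_measurable_torus continuous_on_cis continuous_intros)
  then show "(\<lambda>\<theta>. cis (pairing \<theta> t) * g \<theta>) \<in> borel_measurable torus_measure"
    using borel_measurable_integrable[OF assms] by measurable
qed (simp add: norm_mult)

text \<open>Integrability is included because the integral of a nonintegrable function is 0 by
  convention, which would make the second condition void.\<close>

definition fourier_vanishing :: "(real^'d \<Rightarrow> complex) \<Rightarrow> bool"
  where "fourier_vanishing g \<longleftrightarrow> integrable torus_measure g \<and>
    (\<forall>t. (\<integral>\<theta>. cis (pairing \<theta> t) * g \<theta> \<partial>torus_measure) = 0)"

lemma fourier_vanishing_add: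
  assumes "fourier_vanishing f" "fourier_vanishing g"
  shows "fourier_vanishing (\<lambda>\<theta>. f \<theta> + g \<theta>)"
  using assms
  by (simp add: fourier_vanishing_def distrib_left integrable_cis_pairing_mult)

lemma fourier_vanishing_cmult:
  assumes "fourier_vanishing f"
  shows "fourier_vanishing (\<lambda>\<theta>. c * f \<theta>)"
  using assms by (simp add: fourier_vanishing_def mult.left_commute)

text \<open>Multiplication by a character merely shifts the index of the coefficients. This is what
  carries the induction over polynomials.\<close>

lemma fourier_vanishing_cis_mult:
  assumes "fourier_vanishing f"
  shows "fourier_vanishing (\<lambda>\<theta>. cis (pairing \<theta> s) * f \<theta>)"
  using assms integrable_cis_pairing_mult[of f s]
  by (simp add: fourier_vanishing_def mult.assoc[symmetric] cis_mult flip: pairing_add_right)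

lemma fourier_vanishing_sum:
  assumes "\<And>i. i \<in> I \<Longrightarrow> fourier_vanishing (f i)"
  shows "fourier_vanishing (\<lambda>\<theta>. \<Sum>i\<in>I. f i \<theta>)"
  using assms
proof (induction I rule: infinite_finite_induct)
  case (insert i I)
  then show ?case using fourier_vanishing_add[of "f i"] by simp
qed (simp_all add: fourier_vanishing_def)

text \<open>Sends the cube onto a product of circles in \<open>complex^'d\<close>, where
  trigonometric polynomials are restrictions of ordinary ones and Stone-Weierstrass applies.\<close>

definition cis_vec :: "real^'d \<Rightarrow> complex^'d"
  where "cis_vec \<theta> = (\<chi> k. cis (\<theta> $ k))"

lemma continuous_on_cis_vec [continuous_intros]:
  "continuous_on S f \<Longrightarrow> continuous_on S (\<lambda>x. cis_vec (f x))"
  unfolding cis_vec_def by (intro continuous_intros continuous_on_cis)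

text \<open>Euler's formula in each coordinate: a cos + b sin has the coefficients (a - i b) / 2 and
  (a + i b) / 2 at the two opposite characters.\<close>

lemma linear_cis_vec:
  fixes p :: "complex^'d \<Rightarrow> real"
  assumes "linear p"
  shows "complex_of_real (p (cis_vec \<theta>)) = (\<Sum>k\<in>UNIV.
    Complex (p (axis k 1) / 2) (- p (axis k \<i>) / 2) * cis (pairing \<theta> (axis k 1)) +
    Complex (p (axis k 1) / 2) (p (axis k \<i>) / 2) * cis (pairing \<theta> (axis k (-1))))"
proof -
  have "cis_vec \<theta> = (\<Sum>k\<in>UNIV. cos (\<theta> $ k) *\<^sub>R axis k 1 + sin (\<theta> $ k) *\<^sub>R axis k \<i>)"
    by (simp add: vec_eq_iff cis_vec_def axis_def sum.distrib if_distrib complex_eq_iff cong: if_cong)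
  then have "p (cis_vec \<theta>) = (\<Sum>k\<in>UNIV. cos (\<theta> $ k) * p (axis k 1) + sin (\<theta> $ k) * p (axis k \<i>))"
    by (simp add: linear_sum[OF assms] linear_add[OF assms] linear_scale[OF assms])
  then show ?thesis
    by (simp add: pairing_axis complex_eq_iff algebra_simps flip: sum.distrib)
qed

text \<open>A polynomial in the coordinates of \<open>cis_vec \<theta>\<close> is a trigonometric polynomial.\<close>

lemma fourier_vanishing_polynomial_mult:
  fixes p :: "complex^'d \<Rightarrow> real"
  assumes "real_polynomial_function p" "fourier_vanishing f"
  shows "fourier_vanishing (\<lambda>\<theta>. complex_of_real (p (cis_vec \<theta>)) * f \<theta>)"
  using assms
proof (induction p arbitrary: f rule: real_polynomial_function.induct)
  case (linear p)
  then show ?case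
    unfolding linear_cis_vec[OF bounded_linear.linear[OF linear(1)]] sum_distrib_right distrib_right mult.assoc
    by (intro fourier_vanishing_sum fourier_vanishing_add fourier_vanishing_cmult fourier_vanishing_cis_mult)
next
  case (const c)
  then show ?case by (rule fourier_vanishing_cmult)
next
  case (add p q)
  then show ?case by (simp add: distrib_right fourier_vanishing_add)
next
  case (mult p q)
  then show ?case by (simp add: mult.assoc)
qed

text \<open>A polynomial uniformly within e of \<open>h\<close> on the image of the torus
  contributes 0, and the remainder at most e times the integral of the norm of
  \<open>f\<close>.\<close>

lemma fourier_vanishing_continuous:
  fixes h :: "complex^'d \<Rightarrow> real"
  assumes f: "fourier_vanishing f" and h: "continuous_on UNIV h"
  shows "(\<integral>\<theta>. complex_of_real (h (cis_vec \<theta>)) * f \<theta> \<partial>torus_measure) = 0"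
proof -
  define I where "I = (\<integral>\<theta>. norm (f \<theta>) \<partial>torus_measure)"
  have fi: "integrable torus_measure f" using f by (simp add: fourier_vanishing_def)
  have fm: "f \<in> borel_measurable torus_measure" using fi by auto
  have K: "compact (cis_vec ` (torus :: (real^'d) set))"
    by (intro compact_continuous_image continuous_intros compact_torus)
  have bound: "norm (\<integral>\<theta>. complex_of_real (h (cis_vec \<theta>)) * f \<theta> \<partial>torus_measure) \<le> e * I"
    if e: "e > 0" for e
  proof -
    obtain p where p: "real_polynomial_function p"
      "\<And>z. z \<in> cis_vec ` (torus :: (real^'d) set) \<Longrightarrow> \<bar>h z - p z\<bar> < e"
      using Stone_Weierstrass_real_polynomial_function[OF K _ e, of h] continuous_on_subset[OF h] by blast
    have "continuous_on UNIV p"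
      using continuous_real_polymonial_function[OF p(1)] by (simp add: continuous_at_imp_continuous_on)
    note p_cont = continuous_on_compose2[OF this]
    define r where "r = (\<lambda>\<theta>. complex_of_real (h (cis_vec \<theta>) - p (cis_vec \<theta>)) * f \<theta>)"
    have pv: "fourier_vanishing (\<lambda>\<theta>. complex_of_real (p (cis_vec \<theta>)) * f \<theta>)"
      by (rule fourier_vanishing_polynomial_mult[OF p(1) f])
    then have p0: "(\<integral>\<theta>. complex_of_real (p (cis_vec \<theta>)) * f \<theta> \<partial>torus_measure) = 0"
      unfolding fourier_vanishing_def by (auto dest: spec[of _ 0] simp: pairing_def)
    have "(\<lambda>\<theta>. complex_of_real (h (cis_vec \<theta>) - p (cis_vec \<theta>))) \<in> borel_measurable torus_measure"
      by (intro continuous_on_borel_measurable_torus continuous_on_of_real continuous_on_diff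
          continuous_on_compose2[OF h] p_cont
          continuous_intros) auto
    then have rm: "r \<in> borel_measurable torus_measure"
      unfolding r_def using fm by (rule borel_measurable_times)
    have rb: "norm (r \<theta>) \<le> e * norm (f \<theta>)" if "\<theta> \<in> torus" for \<theta>
      using p(2)[of "cis_vec \<theta>"] that
      by (auto simp: r_def norm_mult simp flip: of_real_diff intro!: mult_right_mono)
    have ei: "integrable torus_measure (\<lambda>\<theta>. e * norm (f \<theta>))"
      using fi by (intro integrable_mult_right integrable_norm)
    have ri: "integrable torus_measure r"
      using rb e by (intro Bochner_Integration.integrable_bound[OF ei rm] AE_I2) (auto simp: abs_mult)
    have "(\<integral>\<theta>. complex_of_real (h (cis_vec \<theta>)) * f \<theta> \<partial>torus_measure)
      = (\<integral>\<theta>. r \<theta> + complex_of_real (p (cis_vec \<theta>)) * f \<theta> \<partial>torus_measure)"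
      by (simp add: r_def algebra_simps)
    also have "\<dots> = (\<integral>\<theta>. r \<theta> \<partial>torus_measure)"
      using ri pv p0 by (simp add: fourier_vanishing_def)
    also have "norm \<dots> \<le> (\<integral>\<theta>. e * norm (f \<theta>) \<partial>torus_measure)"
      using rb by (intro Bochner_Integration.integral_norm_bound_integral ri ei) auto
    finally show ?thesis by (simp add: I_def)
  qed
  have I: "0 \<le> I" by (simp add: I_def)
  have "norm (\<integral>\<theta>. complex_of_real (h (cis_vec \<theta>)) * f \<theta> \<partial>torus_measure) \<le> 0"
  proof (rule field_le_epsilon)
    fix e :: real assume e: "e > 0"
    \<comment> \<open>The added 1 covers the case \<open>I\<close> = 0.\<close>
    have "e / (I + 1) * I \<le> e" using I e by (simp add: field_simps)
    then show "norm (\<integral>\<theta>. complex_of_real (h (cis_vec \<theta>)) * f \<theta> \<partial>torus_measure) \<le> 0 + e"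
      using bound[of "e / (I + 1)"] I e by (smt (verit) divide_pos_pos)
  qed
  then show ?thesis by simp
qed

text \<open>Opposite faces of the cube have the same image, hence the open box for one of the
  points. Coordinates then differ by less than a full period, so the integer multiple of the period
  is 0.\<close>

lemma cis_vec_inj:
  assumes "\<theta> \<in> torus" "\<phi> \<in> box 0 (\<chi> k. 2 * pi)" "cis_vec \<theta> = cis_vec \<phi>"
  shows "\<theta> = \<phi>"
proof -
  have "\<theta> $ k = \<phi> $ k" for k
  proof -
    have "cis (\<theta> $ k) = cis (\<phi> $ k)" using assms(3) by (simp add: cis_vec_def vec_eq_iff)
    then have "sin (\<theta> $ k) = sin (\<phi> $ k) \<and> cos (\<theta> $ k) = cos (\<phi> $ k)"
      by (simp add: complex_eq_iff)
    then obtain n :: int where n: "\<theta> $ k = \<phi> $ k + 2 * pi * n"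
      unfolding sin_cos_eq_iff by blast
    have "0 \<le> \<theta> $ k" "\<theta> $ k \<le> 2 * pi" "0 < \<phi> $ k" "\<phi> $ k < 2 * pi"
      using assms(1,2) by (auto simp: mem_torus mem_box_cart)
    then have "2 * pi * n < 2 * pi * 1" "2 * pi * (-1) < 2 * pi * n"
      using n by linarith+
    then have "n < 1" "-1 < n"
      unfolding mult_less_cancel_left_pos[OF pi_gt_zero[THEN mult_pos_pos[OF zero_less_numeral]]]
      by linarith+
    then show ?thesis using n by simp
  qed
  then show ?thesis by (simp add: vec_eq_iff)
qed

text \<open>Continuous cutoffs decrease to the indicator of the image of \<open>T\<close>, and
  dominated convergence passes to the limit. Injectivity of \<open>cis_vec\<close> over the open box
  identifies that indicator with the one of \<open>T\<close>.\<close>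

lemma fourier_vanishing_compact:
  fixes f :: "real^'d \<Rightarrow> complex"
  assumes f: "fourier_vanishing f" and T: "compact T" "T \<subseteq> box 0 (\<chi> k. 2 * pi)"
  shows "(\<integral>\<theta>. indicator T \<theta> * f \<theta> \<partial>torus_measure) = 0"
proof (cases "T = {}")
  \<comment> \<open>The empty set is set apart because \<open>infdist\<close> to it is 0 by
    convention, so that the cutoffs would be constantly 1.\<close>
  case False
  define C where "C = cis_vec ` T"
  define h where "h = (\<lambda>n z. max 0 (1 - real n * infdist z C))"
  have C: "closed C" "C \<noteq> {}"
    unfolding C_def using T False
    by (auto intro!: compact_imp_closed compact_continuous_image continuous_intros)
  have fi: "integrable torus_measure f" using f by (simp add: fourier_vanishing_def)
  have fm: "f \<in> borel_measurable torus_measure" using fi by auto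
  have h01: "0 \<le> h n z" "h n z \<le> 1" for n z
    by (auto simp: h_def infdist_nonneg)
  have h_cont: "continuous_on UNIV (h n)" for n
    unfolding h_def by (intro continuous_intros)
  have lim: "(\<lambda>n. h n z) \<longlonglongrightarrow> indicator C z" for z
  proof (cases "z \<in> C")
    case False
    then have d: "0 < infdist z C" using C by (meson infdist_pos_not_in_closed)
    then obtain N :: nat where N: "1 < N * infdist z C"
      using reals_Archimedean3 by blast
    have "h n z = 0" if "n \<ge> N" for n
    proof -
      have "N * infdist z C \<le> n * infdist z C" using that d by (intro mult_right_mono) auto
      then show ?thesis using N by (simp add: h_def)
    qed
    then have "\<forall>\<^sub>F n in sequentially. h n z = indicator C z"
      using False by (auto simp: eventually_sequentially)
    then show ?thesis by (rule tendsto_eventually)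
  qed (simp add: h_def)
  have "(\<lambda>n. \<integral>\<theta>. complex_of_real (h n (cis_vec \<theta>)) * f \<theta> \<partial>torus_measure)
      \<longlonglongrightarrow> (\<integral>\<theta>. complex_of_real (indicator C (cis_vec \<theta>)) * f \<theta> \<partial>torus_measure)"
  proof (rule integral_dominated_convergence)
    show "integrable torus_measure (\<lambda>\<theta>. norm (f \<theta>))" using fi by simp
    have hm: "(\<lambda>\<theta>. h n (cis_vec \<theta>)) \<in> borel_measurable torus_measure" for n
      by (intro continuous_on_borel_measurable_torus continuous_on_compose2[OF h_cont] continuous_intros) auto
    then show "(\<lambda>\<theta>. complex_of_real (h n (cis_vec \<theta>)) * f \<theta>) \<in> borel_measurable torus_measure" for n
      using fm by measurable
    have "(\<lambda>\<theta>. indicator C (cis_vec \<theta>) :: real) \<in> borel_measurable torus_measure"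
      by (rule borel_measurable_LIMSEQ_real[OF lim hm])
    then show "(\<lambda>\<theta>. complex_of_real (indicator C (cis_vec \<theta>)) * f \<theta>) \<in> borel_measurable torus_measure"
      using fm by measurable
    show "AE \<theta> in torus_measure. (\<lambda>n. complex_of_real (h n (cis_vec \<theta>)) * f \<theta>)
        \<longlonglongrightarrow> complex_of_real (indicator C (cis_vec \<theta>)) * f \<theta>"
      by (intro AE_I2 tendsto_intros lim)
    show "AE \<theta> in torus_measure. norm (complex_of_real (h n (cis_vec \<theta>)) * f \<theta>) \<le> norm (f \<theta>)" for n
      using h01 by (auto simp: norm_mult intro!: mult_left_le_one_le)
  qed
  then have "(\<integral>\<theta>. complex_of_real (indicator C (cis_vec \<theta>)) * f \<theta> \<partial>torus_measure) = 0"
    using fourier_vanishing_continuous[OF f h_cont] by (simp add: LIMSEQ_const_iff)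
  moreover have "complex_of_real (indicator C (cis_vec \<theta>)) = indicator T \<theta>" if "\<theta> \<in> torus" for \<theta>
    using that T cis_vec_inj by (auto simp: C_def indicator_def)
  then have "(\<integral>\<theta>. indicator T \<theta> * f \<theta> \<partial>torus_measure)
      = (\<integral>\<theta>. complex_of_real (indicator C (cis_vec \<theta>)) * f \<theta> \<partial>torus_measure)"
    by (intro Bochner_Integration.integral_cong) simp_all
  ultimately show ?thesis by simp
qed simp

text \<open>If \<open>u\<close> were positive on a set of positive measure, inner regularity would
  give a compact subset of positive measure on which the integral of \<open>u\<close> cannot vanish.
  The boundary of the cube, which the hypothesis does not reach, is null.\<close>

lemma AE_torus_nonpos:
  fixes u :: "real^'d \<Rightarrow> real"
  assumes u: "integrable torus_measure u"
    and z: "\<And>T. compact T \<Longrightarrow> T \<subseteq> box 0 (\<chi> k. 2 * pi) \<Longrightarrow> (\<integral>\<theta>. indicator T \<theta> * u \<theta> \<partial>torus_measure) = 0"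
  shows "AE \<theta> in torus_measure. u \<theta> \<le> 0"
proof -
  define X :: "(real^'d) set" where "X = box 0 (\<chi> k. 2 * pi)"
  define S where "S = {\<theta> \<in> torus. 0 < u \<theta>} \<inter> X"
  have um: "u \<in> borel_measurable torus_measure" using u by auto
  have "{\<theta> \<in> space torus_measure. 0 < u \<theta>} \<in> sets torus_measure"
    using um by measurable
  then have "{\<theta> \<in> torus. 0 < u \<theta>} \<in> sets lebesgue"
    by (simp add: sets_torus_measure_iff)
  then have S: "S \<in> sets lebesgue" unfolding S_def X_def by (rule sets.Int) simp
  have "emeasure lebesgue S \<le> emeasure lebesgue (torus :: (real^'d) set)"
    by (intro emeasure_mono) (auto simp: S_def)
  then have fin: "emeasure lebesgue S \<noteq> \<infinity>"
    using emeasure_lebesgue_torus_finite[where 'd = 'd] by (auto simp: top_unique)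
  have "emeasure lebesgue S = 0"
  proof (rule ccontr)
    assume "emeasure lebesgue S \<noteq> 0"
    then have pos: "0 < measure lebesgue S"
      using fin by (simp add: measure_def enn2real_positive_iff less_top zero_less_iff_neq_zero)
    \<comment> \<open>The tolerance is the measure of \<open>S\<close> itself, so \<open>T\<close>
      cannot be null.\<close>
    obtain T where T: "closed T" "T \<subseteq> S" "emeasure lebesgue (S - T) < ennreal (measure lebesgue S)"
      using sets_lebesgue_inner_closed[OF S pos] by metis
    have "bounded T"
      by (rule bounded_subset[OF bounded_box[of 0 "\<chi> k. 2 * pi"]])
        (use T(2) in \<open>auto simp: S_def X_def\<close>)
    then have "compact T" using T(1) by (simp add: compact_eq_bounded_closed)
    then have i0: "(\<integral>\<theta>. indicator T \<theta> * u \<theta> \<partial>torus_measure) = 0"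
      using T(2) by (intro z) (auto simp: S_def X_def)
    have Ts: "T \<in> sets torus_measure"
      using T(1,2) by (auto simp: sets_torus_measure_iff S_def)
    have "integrable torus_measure (\<lambda>\<theta>. indicator T \<theta> * u \<theta>)"
      using integrable_mult_indicator[OF Ts u] by simp
    then have "AE \<theta> in torus_measure. indicator T \<theta> * u \<theta> = 0"
      using i0 T(2) by (subst (asm) integral_nonneg_eq_0_iff_AE)
        (auto simp: indicator_def S_def split: if_splits intro!: AE_I2)
    then have "AE \<theta> in lebesgue. \<theta> \<notin> T"
      unfolding AE_torus_measure by eventually_elim (use T(2) in \<open>auto simp: S_def indicator_def\<close>)
    then have "emeasure lebesgue T = 0"
      using T(1) by (subst (asm) AE_iff_measurable[of T]) auto
    moreover have "emeasure lebesgue S = emeasure lebesgue (T \<union> (S - T))"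
      using T(2) by (intro arg_cong[where f = "emeasure lebesgue"]) auto
    moreover have "emeasure lebesgue (T \<union> (S - T)) \<le> emeasure lebesgue T + emeasure lebesgue (S - T)"
      using S T(1) by (intro emeasure_subadditive sets.Diff) auto
    ultimately have "emeasure lebesgue S < ennreal (measure lebesgue S)" using T(3) by simp
    then show False using emeasure_eq_ennreal_measure[OF fin[unfolded infinity_ennreal_def]] by simp
  qed
  then have "AE \<theta> in lebesgue. \<theta> \<notin> S"
    using S by (subst AE_iff_measurable[of S]) auto
  moreover have "AE \<theta> in lebesgue. \<theta> \<notin> torus - X"
    unfolding torus_def X_def
    by (rule AE_not_in[OF negligible_frontier_interval[unfolded negligible_iff_null_sets]])
  ultimately show ?thesis
    unfolding AE_torus_measure by eventually_elim (auto simp: S_def)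
qed

text \<open>The multiples by 1, -1, i and -i bound the real and the imaginary part from both sides
  by 0.\<close>

lemma fourier_vanishing_imp_AE_0:
  fixes f :: "real^'d \<Rightarrow> complex"
  assumes "fourier_vanishing f"
  shows "AE \<theta> in torus_measure. f \<theta> = 0"
proof -
  have fi: "integrable torus_measure f" using assms by (simp add: fourier_vanishing_def)
  have key: "AE \<theta> in torus_measure. Re (c * f \<theta>) \<le> 0" for c
  proof (rule AE_torus_nonpos)
    have cf: "fourier_vanishing (\<lambda>\<theta>. c * f \<theta>)" by (rule fourier_vanishing_cmult[OF assms])
    show "integrable torus_measure (\<lambda>\<theta>. Re (c * f \<theta>))" using fi by (intro integrable_Re integrable_mult_right)
    fix T :: "(real^'d) set" assume T: "compact T" "T \<subseteq> box 0 (\<chi> k. 2 * pi)"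
    have Ts: "T \<in> sets torus_measure"
      using T compact_imp_closed[OF T(1)] box_subset_cbox[of 0 "\<chi> k. 2 * pi"]
      by (auto simp: sets_torus_measure_iff torus_def)
    have "integrable torus_measure (\<lambda>\<theta>. indicator T \<theta> *\<^sub>R (c * f \<theta>))"
      using fi by (intro integrable_mult_indicator Ts integrable_mult_right)
    then have "(\<integral>\<theta>. Re (indicator T \<theta> *\<^sub>R (c * f \<theta>)) \<partial>torus_measure) = 0"
      using fourier_vanishing_compact[OF cf T]
      by (subst integral_Re) (auto simp: scaleR_conv_of_real of_real_indicator)
    then show "(\<integral>\<theta>. indicator T \<theta> * Re (c * f \<theta>) \<partial>torus_measure) = 0" by simp
  qed
  show ?thesis
    using key[of 1] key[of "-1"] key[of \<i>] key[of "-\<i>"]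
    by eventually_elim (simp add: complex_eq_iff)
qed

section \<open>Spectral densities: integrability and reflection symmetry\<close>

lemma bounded_linear_component: "bounded_linear (\<lambda>X :: complex^'n^'m. X $ a $ b)"
  by (rule bounded_linear_compose[OF bounded_linear_vec_nth bounded_linear_vec_nth])

lemma integrable_component:
  fixes \<Phi> :: "'a \<Rightarrow> complex^'n^'m"
  shows "integrable M \<Phi> \<Longrightarrow> integrable M (\<lambda>\<theta>. \<Phi> \<theta> $ a $ b)"
  by (rule integrable_bounded_linear[OF bounded_linear_component])

text \<open>The coefficient is a matrix-valued integral. Taking an entry inside is legitimate
  because the integrand is integrable: the character has modulus 1 and leaves the norm of
  \<open>\<Phi>\<close> unchanged.\<close>

lemma fourier_coeff_component:
  assumes \<Phi>: "integrable torus_measure \<Phi>"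
  shows "fourier_coeff \<Phi> t $ a $ b = (\<integral>\<theta>. cis (pairing \<theta> t) * \<Phi> \<theta> $ a $ b \<partial>torus_measure)"
proof -
  let ?G = "\<lambda>\<theta>. \<chi> a b. cis (pairing \<theta> t) * \<Phi> \<theta> $ a $ b"
  have c: "(\<lambda>\<theta>. cis (pairing \<theta> t)) \<in> borel_measurable torus_measure"
    by (intro continuous_on_borel_measurable_torus continuous_on_cis continuous_intros)
  have "norm (?G \<theta>) = norm (\<Phi> \<theta>)" for \<theta>
    by (simp add: norm_vec_def norm_mult)
  moreover have "?G \<in> borel_measurable torus_measure"
    by (rule borel_measurable_continuous_Pair[OF c borel_measurable_integrable[OF \<Phi>]])
      (intro continuous_intros)
  ultimately have "integrable torus_measure ?G"
    by (intro Bochner_Integration.integrable_bound[OF \<Phi>]) auto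
  from integral_bounded_linear[OF bounded_linear_component this, of a b]
  show ?thesis by (simp add: fourier_coeff_def)
qed

lemma spectral_densitiesE:
  assumes "\<Phi> \<in> spectral_densities"
  obtains c C where "0 < c" "c \<le> C" "AE \<theta> in torus_measure. hermitian (\<Phi> \<theta>) \<and>
    (\<forall>x. c * (norm x)\<^sup>2 \<le> x \<bullet> (\<Phi> \<theta> *v x)) \<and> (\<forall>x. x \<bullet> (\<Phi> \<theta> *v x) \<le> C * (norm x)\<^sup>2)"
proof -
  obtain c C where c: "0 < c" "c \<le> C" and AE: "AE \<theta> in torus_measure.
      hermitian (\<Phi> \<theta>) \<and> loewner_le (c *\<^sub>R mat 1) (\<Phi> \<theta>) \<and> loewner_le (\<Phi> \<theta>) (C *\<^sub>R mat 1)"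
    using assms by (auto simp: spectral_densities_def)
  from AE have "AE \<theta> in torus_measure. hermitian (\<Phi> \<theta>) \<and>
    (\<forall>x. c * (norm x)\<^sup>2 \<le> x \<bullet> (\<Phi> \<theta> *v x)) \<and> (\<forall>x. x \<bullet> (\<Phi> \<theta> *v x) \<le> C * (norm x)\<^sup>2)"
    by eventually_elim (auto simp: loewner_le_scaleR_mat_1_left loewner_le_scaleR_mat_1_right)
  with c show ?thesis by (rule that)
qed

lemma AE_norm_spectral_density:
  fixes \<Phi> :: "real^'d \<Rightarrow> complex^'m^'m"
  assumes "\<Phi> \<in> spectral_densities"
  obtains K where "AE \<theta> in torus_measure. pos_def (\<Phi> \<theta>) \<and> norm (\<Phi> \<theta>) \<le> K"
proof -
  obtain c C where c: "0 < c" and AE: "AE \<theta> in torus_measure. hermitian (\<Phi> \<theta>) \<and>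
    (\<forall>x. c * (norm x)\<^sup>2 \<le> x \<bullet> (\<Phi> \<theta> *v x)) \<and> (\<forall>x. x \<bullet> (\<Phi> \<theta> *v x) \<le> C * (norm x)\<^sup>2)"
    using spectral_densitiesE[OF assms] .
  from AE have "AE \<theta> in torus_measure. pos_def (\<Phi> \<theta>) \<and> norm (\<Phi> \<theta>) \<le> CARD('m) * C"
  proof eventually_elim
    case (elim \<theta>)
    then have "pos_def (\<Phi> \<theta>)" using coercive_imp_pos_def c by blast
    then show ?case using norm_le_of_loewner_le elim by blast
  qed
  then show ?thesis by (rule that)
qed

lemma integrable_spectral_density:
  assumes "\<Phi> \<in> spectral_densities" shows "integrable torus_measure \<Phi>"
proof -
  obtain K where AE: "AE \<theta> in torus_measure. pos_def (\<Phi> \<theta>) \<and> norm (\<Phi> \<theta>) \<le> K"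
    using AE_norm_spectral_density[OF assms] .
  show ?thesis
  proof (rule torus_measure.integrable_const_bound)
    show "AE \<theta> in torus_measure. norm (\<Phi> \<theta>) \<le> K" using AE by eventually_elim simp
  qed (use assms in \<open>simp add: spectral_densities_def\<close>)
qed

lemma cis_pairing_uminus: "cis (- pairing \<theta> t) = cnj (cis (pairing \<theta> t))"
  by (simp add: cis_cnj)

text \<open>In each entry, reflected and conjugated density have the same Fourier coefficients,
  since these are a coefficient of \<open>\<Phi>\<close> and its conjugate; uniqueness of
  coefficients makes the functions agree.\<close>

lemma AE_spectral_density_reflect:
  fixes \<Phi> :: "real^'d \<Rightarrow> complex^'m^'m"
  assumes \<Phi>: "\<Phi> \<in> spectral_densities"
  shows "AE \<theta> in torus_measure. \<Phi> (torus_reflect \<theta>) = conj_mat (\<Phi> \<theta>)"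
proof -
  have int: "integrable torus_measure \<Phi>" by (rule integrable_spectral_density[OF \<Phi>])
  have "AE \<theta> in torus_measure. \<Phi> (torus_reflect \<theta>) $ a $ b - cnj (\<Phi> \<theta> $ a $ b) = 0" for a b
  proof (rule fourier_vanishing_imp_AE_0)
    have i1: "integrable torus_measure (\<lambda>\<theta>. \<Phi> \<theta> $ a $ b)" by (rule integrable_component[OF int])
    have i2: "integrable torus_measure (\<lambda>\<theta>. \<Phi> (torus_reflect \<theta>) $ a $ b)"
      by (rule integrable_torus_reflect[OF i1])
    have i3: "integrable torus_measure (\<lambda>\<theta>. cnj (\<Phi> \<theta> $ a $ b))" using i1 by simp
    have "(\<integral>\<theta>. cis (pairing \<theta> t) * (\<Phi> (torus_reflect \<theta>) $ a $ b - cnj (\<Phi> \<theta> $ a $ b)) \<partial>torus_measure) = 0" for t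
    proof -
      \<comment> \<open>The index changes sign because reflection, like conjugation, inverts the
        characters.\<close>
      define q where "q = fourier_coeff \<Phi> (- t) $ a $ b"
      have q: "cnj q = q" using \<Phi> by (auto simp: q_def spectral_densities_def Reals_cnj_iff)
      have q': "q = (\<integral>\<theta>. cis (- pairing \<theta> t) * \<Phi> \<theta> $ a $ b \<partial>torus_measure)"
        unfolding q_def by (simp add: fourier_coeff_component[OF int] pairing_minus_right)
      let ?F = "\<lambda>\<theta>. cis (- pairing \<theta> t) * \<Phi> \<theta> $ a $ b"
      have "?F \<in> borel_measurable torus_measure"
        using integrable_cis_pairing_mult[OF i1, of "- t"]
        by (intro borel_measurable_integrable) (simp add: pairing_minus_right)
      from integral_torus_reflect[OF this]
      have 1: "(\<integral>\<theta>. cis (pairing \<theta> t) * \<Phi> (torus_reflect \<theta>) $ a $ b \<partial>torus_measure) = q"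
        unfolding q' cis_pairing_uminus
        by (simp add: cis_pairing_reflect cis_cnj)
      have "(\<integral>\<theta>. cis (pairing \<theta> t) * cnj (\<Phi> \<theta> $ a $ b) \<partial>torus_measure)
          = (\<integral>\<theta>. cnj (cis (- pairing \<theta> t) * \<Phi> \<theta> $ a $ b) \<partial>torus_measure)"
        by (simp add: cis_cnj)
      also have "\<dots> = cnj q" unfolding q' by (rule Bochner_Integration.integral_cnj)
      finally have 2: "(\<integral>\<theta>. cis (pairing \<theta> t) * cnj (\<Phi> \<theta> $ a $ b) \<partial>torus_measure) = q"
        by (simp add: q)
      show ?thesis
        unfolding right_diff_distrib
        by (subst Bochner_Integration.integral_diff) (auto intro!: integrable_cis_pairing_mult i2 i3 simp: 1 2)
    qed
    then show "fourier_vanishing (\<lambda>\<theta>. \<Phi> (torus_reflect \<theta>) $ a $ b - cnj (\<Phi> \<theta> $ a $ b))"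
      using i2 i3 by (simp add: fourier_vanishing_def)
  qed
  then have "AE \<theta> in torus_measure. \<forall>a\<in>UNIV. \<forall>b\<in>UNIV.
      \<Phi> (torus_reflect \<theta>) $ a $ b - cnj (\<Phi> \<theta> $ a $ b) = 0"
    by (intro AE_finite_allI) auto
  then show ?thesis
    by eventually_elim (simp add: vec_eq_iff conj_mat_def)
qed

text \<open>Substituting the reflected variable conjugates the integrand, so the coefficient equals
  its own conjugate.\<close>

lemma fourier_coeff_real:
  fixes \<Phi> :: "real^'d \<Rightarrow> complex^'m^'m"
  assumes int: "integrable torus_measure \<Phi>"
    and sym: "AE \<theta> in torus_measure. \<Phi> (torus_reflect \<theta>) = conj_mat (\<Phi> \<theta>)"
  shows "fourier_coeff \<Phi> t $ a $ b \<in> \<real>"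
proof -
  let ?F = "\<lambda>\<theta>. cis (pairing \<theta> t) * \<Phi> \<theta> $ a $ b"
  have Fi: "integrable torus_measure ?F"
    by (intro integrable_cis_pairing_mult integrable_component[OF int])
  have "(\<integral>\<theta>. ?F \<theta> \<partial>torus_measure) = (\<integral>\<theta>. ?F (torus_reflect \<theta>) \<partial>torus_measure)"
    by (rule integral_torus_reflect[OF borel_measurable_integrable[OF Fi], symmetric])
  also have "\<dots> = (\<integral>\<theta>. cnj (?F \<theta>) \<partial>torus_measure)"
  proof (rule integral_cong_AE)
    show "(\<lambda>\<theta>. ?F (torus_reflect \<theta>)) \<in> borel_measurable torus_measure"
      by (rule borel_measurable_integrable[OF integrable_torus_reflect[OF Fi]])
    show "(\<lambda>\<theta>. cnj (?F \<theta>)) \<in> borel_measurable torus_measure"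
      by (rule borel_measurable_integrable[OF integrable_bounded_linear[OF bounded_linear_cnj Fi]])
    show "AE \<theta> in torus_measure. ?F (torus_reflect \<theta>) = cnj (?F \<theta>)"
      using sym by eventually_elim (simp add: cis_pairing_reflect conj_mat_def cis_cnj)
  qed
  also have "\<dots> = cnj (\<integral>\<theta>. ?F \<theta> \<partial>torus_measure)" by (rule Bochner_Integration.integral_cnj)
  finally show ?thesis by (simp add: fourier_coeff_component[OF int] Reals_cnj_iff)
qed

section \<open>Continuity and reflection symmetry of the series \<open>H\<close>\<close>

lemma norm_fourier_series_term:
  "norm (\<chi> a b. complex_of_real (h $ a $ b) * cis y) = norm (h :: real^'n^'m)"
  by (simp add: norm_vec_def norm_mult)

lemma continuous_on_fourier_series:
  fixes h :: "int^'d \<Rightarrow> real^'m^'m"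
  assumes "(\<lambda>t. norm (h t)) summable_on UNIV"
  shows "continuous_on UNIV (fourier_series h)"
proof -
  have "uniform_limit UNIV
    (\<lambda>T \<theta>. \<Sum>t\<in>T. \<chi> a b. complex_of_real (h t $ a $ b) * cis (- pairing \<theta> t)) (fourier_series h)
    (finite_subsets_at_top UNIV)"
    unfolding fourier_series_def[abs_def]
    by (rule Weierstrass_m_test_general[OF _ assms]) (simp only: norm_fourier_series_term order_refl)
  then show ?thesis
    by (rule uniform_limit_theorem[rotated])
      (auto intro!: always_eventually continuous_intros continuous_on_cis)
qed

lemma norm_conj_mat: "norm (conj_mat A) = norm A"
  by (simp add: conj_mat_def norm_vec_def)

lemma bounded_linear_conj_mat: "bounded_linear (conj_mat :: complex^'n^'m \<Rightarrow> _)"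
  by (rule bounded_linear_intro[where K = 1])
    (auto simp: conj_mat_simps norm_conj_mat)

text \<open>As the coefficients are real, conjugation affects only the characters; absolute
  summability lets it pass through the infinite sum.\<close>

lemma fourier_series_reflect:
  fixes h :: "int^'d \<Rightarrow> real^'m^'m"
  assumes "(\<lambda>t. norm (h t)) summable_on UNIV"
  shows "fourier_series h (torus_reflect \<theta>) = conj_mat (fourier_series h \<theta>)"
proof -
  let ?g = "\<lambda>t. \<chi> a b. complex_of_real (h t $ a $ b) * cis (- pairing \<theta> t)"
  have "(\<lambda>t. norm (?g t)) summable_on UNIV"
    unfolding norm_fourier_series_term by (rule assms)
  then have "(?g has_sum fourier_series h \<theta>) UNIV"
    unfolding fourier_series_def by (rule has_sum_infsum[OF abs_summable_summable])
  from has_sum_bounded_linear[OF bounded_linear_conj_mat this]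
  have "(\<Sum>\<^sub>\<infinity>t. conj_mat (?g t)) = conj_mat (fourier_series h \<theta>)" by (rule infsumI)
  moreover have "cis (- pairing (torus_reflect \<theta>) t) = cis (pairing \<theta> t)" for t
    by (metis cis_pairing_reflect cis_cnj add.inverse_inverse)
  then have "conj_mat (?g t) = (\<chi> a b. complex_of_real (h t $ a $ b) * cis (- pairing (torus_reflect \<theta>) t))" for t
    by (simp add: conj_mat_def vec_eq_iff cis_cnj)
  ultimately show ?thesis by (simp add: fourier_series_def)
qed

subsection \<open>The weighted Hellinger distance\<close>

lemma norm_matrix_mult_mono:
  fixes A :: "complex^'n^'m" and B :: "complex^'k^'n"
  shows "norm A \<le> a \<Longrightarrow> norm B \<le> b \<Longrightarrow> norm (A ** B) \<le> a * b"
  by (meson mult_mono norm_ge_zero norm_matrix_mult order_trans)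

lemma weighted_norm_scaleR: "weighted_norm W (r *\<^sub>R A) = \<bar>r\<bar> * weighted_norm W A"
proof -
  have "Re (trace (conj_transpose (r *\<^sub>R A) ** W ** (r *\<^sub>R A))) = r\<^sup>2 * Re (trace (conj_transpose A ** W ** A))"
    by (simp add: conj_transpose_scaleR matrix_mult_scaleR_left matrix_mult_scaleR_right trace_scaleR power2_eq_square)
  then show ?thesis by (simp add: weighted_norm_def real_sqrt_mult)
qed

lemma borel_measurable_trace:
  fixes \<Phi> :: "'a \<Rightarrow> complex^'m^'m"
  assumes "\<Phi> \<in> borel_measurable M" shows "(\<lambda>\<theta>. trace (\<Phi> \<theta>)) \<in> borel_measurable M"
  by (rule borel_measurable_continuous_on[OF _ assms])
    (rule bounded_linear.continuous_on[OF bounded_linear_trace continuous_on_id])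

text \<open>In the definition the trace stands outside a matrix-valued integral. The bounds make the
  integrand integrable, so that the trace can move inside and be evaluated pointwise by the
  factorization.\<close>

lemma hellinger_dist_factorization:
  fixes \<Phi> \<Psi> \<Omega> F G :: "real^'d \<Rightarrow> complex^'m^'m"
  assumes meas: "\<Phi> \<in> borel_measurable torus_measure" "\<Psi> \<in> borel_measurable torus_measure"
      "\<Omega> \<in> borel_measurable torus_measure" "F \<in> borel_measurable torus_measure"
      "G \<in> borel_measurable torus_measure"
    and bound: "AE \<theta> in torus_measure. norm (\<Phi> \<theta>) \<le> K \<and> norm (\<Psi> \<theta>) \<le> K \<and> norm (\<Omega> \<theta>) \<le> K"
    and fact: "AE \<theta> in torus_measure. pos_def (\<Phi> \<theta>) \<and> pos_semidef (\<Omega> \<theta>) \<and>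
      \<Phi> \<theta> = F \<theta> ** conj_transpose (F \<theta>) \<and> \<Psi> \<theta> = G \<theta> ** conj_transpose (G \<theta>) \<and>
      pos_semidef (conj_transpose (F \<theta>) ** \<Omega> \<theta> ** G \<theta>)"
  shows "hellinger_dist \<Omega> \<Phi> \<Psi> = sqrt (\<integral>\<theta>. (weighted_norm (\<Omega> \<theta>) (F \<theta> - G \<theta>))\<^sup>2 \<partial>torus_measure)"
proof -
  define R where "R = (\<lambda>\<theta>. psd_sqrt (psd_sqrt (\<Phi> \<theta>) ** \<Omega> \<theta> ** \<Psi> \<theta> ** \<Omega> \<theta> ** psd_sqrt (\<Phi> \<theta>)))"
  define X where "X = (\<lambda>\<theta>. \<Omega> \<theta> ** \<Phi> \<theta> + \<Omega> \<theta> ** \<Psi> \<theta> - 2 *\<^sub>R R \<theta>)"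
  define I where "I = (\<integral>\<theta>. (weighted_norm (\<Omega> \<theta>) (F \<theta> - G \<theta>))\<^sup>2 \<partial>torus_measure)"
  have "(\<lambda>\<theta>. psd_sqrt (\<Phi> \<theta>)) \<in> borel_measurable torus_measure"
    by (rule measurable_compose[OF meas(1) borel_measurable_psd_sqrt])
  then have "R \<in> borel_measurable torus_measure"
    unfolding R_def
    by (intro measurable_compose[OF _ borel_measurable_psd_sqrt] borel_measurable_matrix_mult meas)
  then have Xm: "X \<in> borel_measurable torus_measure"
    unfolding X_def using meas
    by (intro borel_measurable_diff borel_measurable_add borel_measurable_matrix_mult borel_measurable_scaleR) auto
  \<comment> \<open>With m = CARD('m), the root of \<Phi> has squared norm at most m K, so the
    square of \<open>R \<theta>\<close> has norm at most m K^4. The root estimate, applied a second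
    time, yields m K^2 for \<open>R \<theta>\<close>.\<close>
  have "AE \<theta> in torus_measure. norm (X \<theta>) \<le> K * K + K * K + 2 * (CARD('m) * K\<^sup>2)"
    using bound fact
  proof eventually_elim
    case (elim \<theta>)
    then have pd: "pos_def (F \<theta> ** conj_transpose (F \<theta>))" and h: "hermitian (\<Omega> \<theta>)"
      by (auto simp: pos_semidef_inner)
    note fac = psd_sqrt_factorization[OF pd _ h, of "G \<theta>"]
    have R: "pos_semidef (R \<theta>)"
      "R \<theta> ** R \<theta> = psd_sqrt (\<Phi> \<theta>) ** \<Omega> \<theta> ** \<Psi> \<theta> ** \<Omega> \<theta> ** psd_sqrt (\<Phi> \<theta>)"
      using fac(1,2) elim unfolding R_def by metis+
    let ?S = "psd_sqrt (\<Phi> \<theta>)"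
    have K: "0 \<le> K" using elim norm_ge_zero order_trans by blast
    have "(norm ?S)\<^sup>2 \<le> CARD('m) * norm (\<Phi> \<theta>)"
      using elim by (intro power2_norm_pos_semidef_root pos_semidef_psd_sqrt psd_sqrt_square) auto
    also have "\<dots> \<le> CARD('m) * K" using elim by (intro mult_left_mono) auto
    finally have S: "(norm ?S)\<^sup>2 \<le> CARD('m) * K" .
    have "norm (R \<theta> ** R \<theta>) \<le> norm ?S * K * K * K * norm ?S"
      unfolding R(2) using elim by (intro norm_matrix_mult_mono) auto
    also have "\<dots> = (norm ?S)\<^sup>2 * (K * K * K)" by (simp add: power2_eq_square)
    also have "\<dots> \<le> CARD('m) * K * (K * K * K)" using S K by (intro mult_right_mono) auto
    finally have Z: "norm (R \<theta> ** R \<theta>) \<le> CARD('m) * K * (K * K * K)" .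
    have "(norm (R \<theta>))\<^sup>2 \<le> CARD('m) * norm (R \<theta> ** R \<theta>)"
      by (rule power2_norm_pos_semidef_root[OF R(1) refl])
    also have "\<dots> \<le> CARD('m) * (CARD('m) * K * (K * K * K))"
      using Z by (intro mult_left_mono) auto
    also have "\<dots> = (CARD('m) * K\<^sup>2)\<^sup>2" by (simp add: power2_eq_square)
    finally have "norm (R \<theta>) \<le> CARD('m) * K\<^sup>2" by (rule power2_le_imp_le) simp
    moreover have "norm (\<Omega> \<theta> ** \<Phi> \<theta>) \<le> K * K" "norm (\<Omega> \<theta> ** \<Psi> \<theta>) \<le> K * K"
      using elim by (auto intro: norm_matrix_mult_mono)
    ultimately show ?case
      unfolding X_def
      by (intro order_trans[OF norm_triangle_ineq4] order_trans[OF norm_triangle_ineq] add_mono) auto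
  qed
  then have Xi: "integrable torus_measure X"
    by (rule torus_measure.integrable_const_bound) (rule Xm)
  have "trace (\<integral>\<theta>. X \<theta> \<partial>torus_measure) = (\<integral>\<theta>. trace (X \<theta>) \<partial>torus_measure)"
    by (rule integral_bounded_linear[OF bounded_linear_trace Xi, symmetric])
  also have "\<dots> = (\<integral>\<theta>. complex_of_real ((weighted_norm (\<Omega> \<theta>) (F \<theta> - G \<theta>))\<^sup>2) \<partial>torus_measure)"
  proof (rule integral_cong_AE)
    show "(\<lambda>\<theta>. trace (X \<theta>)) \<in> borel_measurable torus_measure"
      by (intro borel_measurable_integrable integrable_bounded_linear[OF bounded_linear_trace Xi])
    show "(\<lambda>\<theta>. complex_of_real ((weighted_norm (\<Omega> \<theta>) (F \<theta> - G \<theta>))\<^sup>2)) \<in> borel_measurable torus_measure"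
    proof -
      have "(\<lambda>\<theta>. trace (conj_transpose (F \<theta> - G \<theta>) ** \<Omega> \<theta> ** (F \<theta> - G \<theta>)))
          \<in> borel_measurable torus_measure"
        by (intro borel_measurable_trace borel_measurable_matrix_mult borel_measurable_conj_transpose
            borel_measurable_diff meas)
      then show ?thesis unfolding weighted_norm_def by measurable
    qed
    show "AE \<theta> in torus_measure. trace (X \<theta>) = complex_of_real ((weighted_norm (\<Omega> \<theta>) (F \<theta> - G \<theta>))\<^sup>2)"
      using fact
    proof eventually_elim
      case (elim \<theta>)
      then have eq: "\<Phi> \<theta> = F \<theta> ** conj_transpose (F \<theta>)" "\<Psi> \<theta> = G \<theta> ** conj_transpose (G \<theta>)"
        and ps: "pos_def (F \<theta> ** conj_transpose (F \<theta>))" "pos_semidef (\<Omega> \<theta>)"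
          "pos_semidef (conj_transpose (F \<theta>) ** \<Omega> \<theta> ** G \<theta>)"
        by auto
      show ?case
        unfolding X_def R_def eq by (rule trace_hellinger_integrand[OF ps(1,3,2)])
    qed
  qed
  also have "\<dots> = complex_of_real I"
    unfolding I_def by (rule integral_complex_of_real)
  finally have tr: "trace (\<integral>\<theta>. X \<theta> \<partial>torus_measure) = complex_of_real I" .
  have I: "0 \<le> I" by (simp add: I_def)
  have "hellinger_dist \<Omega> \<Phi> \<Psi> = (THE r. 0 \<le> r \<and> complex_of_real (r\<^sup>2) = complex_of_real I)"
    unfolding hellinger_dist_def tr[symmetric] X_def R_def ..
  also have "\<dots> = sqrt I"
  proof (rule the_equality)
    show "0 \<le> sqrt I \<and> complex_of_real ((sqrt I)\<^sup>2) = complex_of_real I" using I by simp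
    fix r assume r: "0 \<le> r \<and> complex_of_real (r\<^sup>2) = complex_of_real I"
    then have "r\<^sup>2 = I" unfolding of_real_eq_iff by blast
    then show "r = sqrt I" using r by (simp add: real_sqrt_unique)
  qed
  finally show ?thesis by (simp add: I_def)
qed


section \<open>From single frequencies to the path of densities\<close>

lemma (in density_pair) F_eq:
  "F \<tau> = (1 - \<tau>) *\<^sub>R psd_sqrt P + \<tau> *\<^sub>R (psd_sqrt Q ** (matrix_inv (psd_sqrt Q) ** matrix_inv W **
    matrix_inv (psd_sqrt P) ** psd_sqrt (psd_sqrt P ** W ** Q ** W ** psd_sqrt P)))"
  by (simp add: F_def A_def B_def M_def U_def)

theorem mainTheorem5:
  fixes \<Phi>0 \<Phi>1 \<Omega> H U :: "real^'d \<Rightarrow> complex^'m^'m"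
    and h :: "int^'d \<Rightarrow> real^'m^'m"
    and P :: "real \<Rightarrow> real^'d \<Rightarrow> complex^'m^'m"
  assumes "\<Phi>0 \<in> spectral_densities" and "\<Phi>1 \<in> spectral_densities"
    and "(\<lambda>t. norm (h t)) summable_on UNIV"
    and "\<And>\<theta>. \<theta> \<in> torus \<Longrightarrow> H \<theta> = fourier_series h \<theta>"
    and "\<And>\<theta>. \<theta> \<in> torus \<Longrightarrow> \<Omega> \<theta> = H \<theta> ** conj_transpose (H \<theta>)"
    and "\<And>\<theta>. \<theta> \<in> torus \<Longrightarrow> pos_def (\<Omega> \<theta>)"
    and "\<And>\<theta>. \<theta> \<in> torus \<Longrightarrow> U \<theta> =
      matrix_inv (psd_sqrt (\<Phi>1 \<theta>)) ** matrix_inv (\<Omega> \<theta>) ** matrix_inv (psd_sqrt (\<Phi>0 \<theta>)) **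
      psd_sqrt (psd_sqrt (\<Phi>0 \<theta>) ** \<Omega> \<theta> ** \<Phi>1 \<theta> ** \<Omega> \<theta> ** psd_sqrt (\<Phi>0 \<theta>))"
    and "\<And>\<tau> \<theta>. \<tau> \<in> {0..1} \<Longrightarrow> \<theta> \<in> torus \<Longrightarrow> P \<tau> \<theta> =
      ((1 - \<tau>) *\<^sub>R psd_sqrt (\<Phi>0 \<theta>) + \<tau> *\<^sub>R (psd_sqrt (\<Phi>1 \<theta>) ** U \<theta>)) **
      conj_transpose ((1 - \<tau>) *\<^sub>R psd_sqrt (\<Phi>0 \<theta>) + \<tau> *\<^sub>R (psd_sqrt (\<Phi>1 \<theta>) ** U \<theta>))"
  shows "all_pass U
    \<and> (hellinger_dist \<Omega> \<Phi>0 \<Phi>1)\<^sup>2 =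
        (\<integral>\<theta>. (weighted_norm (\<Omega> \<theta>) (psd_sqrt (\<Phi>0 \<theta>) - psd_sqrt (\<Phi>1 \<theta>) ** U \<theta>))\<^sup>2 \<partial>torus_measure)
    \<and> is_hellinger_geodesic \<Omega> P \<Phi>0 \<Phi>1"
proof -
  note \<Omega>_eq = assms(5) and \<Omega>_pd = assms(6) and U_eq = assms(7) and P_eq = assms(8)
  define F where F_path: "F = (\<lambda>\<tau> \<theta>. (1 - \<tau>) *\<^sub>R psd_sqrt (\<Phi>0 \<theta>) + \<tau> *\<^sub>R (psd_sqrt (\<Phi>1 \<theta>) ** U \<theta>))"
  have P_F: "P \<tau> \<theta> = F \<tau> \<theta> ** conj_transpose (F \<tau> \<theta>)" if "\<tau> \<in> {0..1}" "\<theta> \<in> torus" for \<tau> \<theta>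
    using P_eq[OF that] by (simp add: F_path)
  have AE_torus: "AE \<theta> in torus_measure. \<theta> \<in> (torus :: (real^'d) set)"
    by (simp add: AE_torus_measure)

  \<comment> \<open>Absolute summability makes the weight continuous, and compactness turns its
    pointwise positivity into the uniform bounds \<open>w\<close> and \<open>w'\<close>.\<close>
  have "continuous_on torus H"
    using continuous_on_subset[OF continuous_on_fourier_series[OF assms(3)] subset_UNIV]
    by (rule continuous_on_eq) (simp add: assms(4))
  then have "continuous_on torus (\<lambda>\<theta>. H \<theta> ** conj_transpose (H \<theta>))"
    by (intro continuous_intros)
  then have \<Omega>_cont: "continuous_on torus \<Omega>"
    by (rule continuous_on_eq) (simp add: \<Omega>_eq)
  obtain w where w: "0 < w" "\<And>\<theta> x. \<theta> \<in> torus \<Longrightarrow> w * (norm x)\<^sup>2 \<le> x \<bullet> (\<Omega> \<theta> *v x)"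
    using uniformly_coercive[OF compact_torus \<Omega>_cont \<Omega>_pd] by blast
  have "bounded (\<Omega> ` torus)"
    by (intro compact_imp_bounded compact_continuous_image \<Omega>_cont compact_torus)
  then obtain w' where w': "0 < w'" "\<And>\<theta>. \<theta> \<in> torus \<Longrightarrow> norm (\<Omega> \<theta>) \<le> w'"
    unfolding bounded_pos by auto

  obtain c0 C0 where c0: "0 < c0" "c0 \<le> C0" "AE \<theta> in torus_measure. hermitian (\<Phi>0 \<theta>) \<and>
    (\<forall>x. c0 * (norm x)\<^sup>2 \<le> x \<bullet> (\<Phi>0 \<theta> *v x)) \<and> (\<forall>x. x \<bullet> (\<Phi>0 \<theta> *v x) \<le> C0 * (norm x)\<^sup>2)"
    using spectral_densitiesE[OF assms(1)] .
  obtain c1 C1 where c1: "0 < c1" "c1 \<le> C1" "AE \<theta> in torus_measure. hermitian (\<Phi>1 \<theta>) \<and>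
    (\<forall>x. c1 * (norm x)\<^sup>2 \<le> x \<bullet> (\<Phi>1 \<theta> *v x)) \<and> (\<forall>x. x \<bullet> (\<Phi>1 \<theta> *v x) \<le> C1 * (norm x)\<^sup>2)"
    using spectral_densitiesE[OF assms(2)] .
  define c where "c = min c0 c1"
  define C where "C = max C0 C1"
  have cC: "0 < c" "0 < C" using c0 c1 by (auto simp: c_def C_def)

  \<comment> \<open>The frequencies where all pointwise hypotheses hold with common constants.
    Membership in \<open>torus\<close> is recorded because \<open>U\<close>, \<open>P\<close> and
    \<open>\<Omega>\<close> are prescribed only there.\<close>
  define good where "good = (\<lambda>\<theta>. density_pair (\<Phi>0 \<theta>) (\<Phi>1 \<theta>) (\<Omega> \<theta>) \<and> \<theta> \<in> torus \<and>
    (\<forall>x. c * (norm x)\<^sup>2 \<le> x \<bullet> (\<Phi>0 \<theta> *v x) \<and> x \<bullet> (\<Phi>0 \<theta> *v x) \<le> C * (norm x)\<^sup>2) \<and>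
    (\<forall>x. c * (norm x)\<^sup>2 \<le> x \<bullet> (\<Phi>1 \<theta> *v x) \<and> x \<bullet> (\<Phi>1 \<theta> *v x) \<le> C * (norm x)\<^sup>2))"
  have good: "AE \<theta> in torus_measure. good \<theta>"
    using c0(3) c1(3) AE_torus
  proof eventually_elim
    case (elim \<theta>)
    have "c * (norm x)\<^sup>2 \<le> c0 * (norm x)\<^sup>2" "c * (norm x)\<^sup>2 \<le> c1 * (norm x)\<^sup>2"
      "C0 * (norm x)\<^sup>2 \<le> C * (norm x)\<^sup>2" "C1 * (norm x)\<^sup>2 \<le> C * (norm x)\<^sup>2" for x :: "complex^'m"
      by (intro mult_right_mono; simp add: c_def C_def)+
    moreover have "density_pair (\<Phi>0 \<theta>) (\<Phi>1 \<theta>) (\<Omega> \<theta>)"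
      using elim coercive_imp_pos_def[of "\<Phi>0 \<theta>" c0] coercive_imp_pos_def[of "\<Phi>1 \<theta>" c1] c0(1) c1(1)
      by (intro density_pair.intro \<Omega>_pd) blast+
    ultimately show ?case using elim unfolding good_def by (meson order_trans)
  qed
  have F_good: "F \<tau> \<theta> = density_pair.F (\<Phi>0 \<theta>) (\<Phi>1 \<theta>) (\<Omega> \<theta>) \<tau>" if "good \<theta>" for \<tau> \<theta>
  proof -
    interpret d: density_pair "\<Phi>0 \<theta>" "\<Phi>1 \<theta>" "\<Omega> \<theta>" using that by (simp add: good_def)
    show ?thesis using that by (simp add: d.F_eq F_path U_eq good_def)
  qed

  have meas: "\<Phi>0 \<in> borel_measurable torus_measure" "\<Phi>1 \<in> borel_measurable torus_measure"
    using assms(1,2) by (auto simp: spectral_densities_def)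
  have \<Omega>_meas: "\<Omega> \<in> borel_measurable torus_measure"
    by (rule continuous_on_borel_measurable_torus[OF \<Omega>_cont])
  note comp_meas = measurable_compose[OF _ borel_measurable_psd_sqrt]
    measurable_compose[OF _ borel_measurable_matrix_inv]
  have "(\<lambda>\<theta>. matrix_inv (psd_sqrt (\<Phi>1 \<theta>)) ** matrix_inv (\<Omega> \<theta>) ** matrix_inv (psd_sqrt (\<Phi>0 \<theta>)) **
      psd_sqrt (psd_sqrt (\<Phi>0 \<theta>) ** \<Omega> \<theta> ** \<Phi>1 \<theta> ** \<Omega> \<theta> ** psd_sqrt (\<Phi>0 \<theta>)))
      \<in> borel_measurable torus_measure"
    by (intro borel_measurable_matrix_mult comp_meas meas \<Omega>_meas)
  then have "U \<in> borel_measurable torus_measure"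
    using U_eq by (subst measurable_cong) auto
  then have F_meas: "F \<tau> \<in> borel_measurable torus_measure" for \<tau>
    unfolding F_path
    by (intro borel_measurable_add borel_measurable_scaleR borel_measurable_matrix_mult comp_meas
        meas borel_measurable_const)
  have P_meas: "P \<tau> \<in> borel_measurable torus_measure" if "\<tau> \<in> {0..1}" for \<tau>
  proof -
    have "(\<lambda>\<theta>. F \<tau> \<theta> ** conj_transpose (F \<tau> \<theta>)) \<in> borel_measurable torus_measure"
      by (intro borel_measurable_matrix_mult borel_measurable_conj_transpose F_meas)
    then show ?thesis using P_F[OF that] by (subst measurable_cong) auto
  qed

  \<comment> \<open>The constant of \<open>F_lower\<close>, the same for all \<tau> and all good
    frequencies.\<close>
  define k where "k = w * c / (2 * w')"
  have k: "0 < k" using w w' cC by (simp add: k_def)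
  have P_bounds: "pos_def (P \<tau> \<theta>) \<and> (\<forall>x. k * (norm x)\<^sup>2 \<le> x \<bullet> (P \<tau> \<theta> *v x)) \<and>
      (\<forall>x. x \<bullet> (P \<tau> \<theta> *v x) \<le> C * (norm x)\<^sup>2)" if \<tau>: "\<tau> \<in> {0..1}" and g: "good \<theta>" for \<tau> \<theta>
  proof -
    interpret d: density_pair "\<Phi>0 \<theta>" "\<Phi>1 \<theta>" "\<Omega> \<theta>" using g by (simp add: good_def)
    have \<theta>: "\<theta> \<in> torus" using g by (simp add: good_def)
    have PF: "P \<tau> \<theta> = d.F \<tau> ** conj_transpose (d.F \<tau>)"
      by (simp add: P_F[OF \<tau> \<theta>] F_good[OF g])
    have lower: "k * (norm x)\<^sup>2 \<le> x \<bullet> (P \<tau> \<theta> *v x)" for x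
      unfolding PF k_def
      using g w w' \<theta> cC by (intro d.F_lower[OF \<tau>]) (auto simp: good_def)
    have upper: "x \<bullet> (P \<tau> \<theta> *v x) \<le> C * (norm x)\<^sup>2" for x
      unfolding PF using g cC by (intro d.F_upper[OF \<tau>]) (auto simp: good_def)
    have "hermitian (P \<tau> \<theta>)" by (simp add: PF hermitian_def conj_transpose_mult)
    then show ?thesis using lower upper coercive_imp_pos_def k by blast
  qed

  have P_density: "P \<tau> \<in> spectral_densities" if \<tau>: "\<tau> \<in> {0..1}" for \<tau>
  proof -
    have bd: "AE \<theta> in torus_measure. norm (P \<tau> \<theta>) \<le> CARD('m) * C"
      using good by eventually_elim (use P_bounds[OF \<tau>] norm_le_of_loewner_le in blast)
    have int: "integrable torus_measure (P \<tau>)"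
      by (rule torus_measure.integrable_const_bound[OF bd P_meas[OF \<tau>]])
    \<comment> \<open>Both \<theta> and its reflection have to be good, as \<open>F\<close> is
      identified with the locale's path at either point; reflection preserves null sets.\<close>
    have "AE \<theta> in torus_measure. P \<tau> (torus_reflect \<theta>) = conj_mat (P \<tau> \<theta>)"
      using good AE_torus_reflect[OF good] AE_spectral_density_reflect[OF assms(1)]
        AE_spectral_density_reflect[OF assms(2)]
    proof eventually_elim
      case (elim \<theta>)
      have \<theta>: "\<theta> \<in> torus" "torus_reflect \<theta> \<in> torus" using elim by (auto simp: good_def)
      interpret d: density_pair "\<Phi>0 \<theta>" "\<Phi>1 \<theta>" "\<Omega> \<theta>" using elim by (simp add: good_def)
      have "\<Omega> (torus_reflect \<theta>) = conj_mat (\<Omega> \<theta>)"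
        using \<theta> by (simp add: \<Omega>_eq assms(4) fourier_series_reflect[OF assms(3)] conj_mat_simps)
      then have "F \<tau> (torus_reflect \<theta>) = conj_mat (F \<tau> \<theta>)"
        using elim by (simp add: F_good d.F_conj_mat)
      then show ?case using \<theta> by (simp add: P_F[OF \<tau>] conj_mat_simps)
    qed
    then have real: "fourier_coeff (P \<tau>) t $ a $ b \<in> \<real>" for t a b
      by (rule fourier_coeff_real[OF int])
    \<comment> \<open>Taking \<open>max k C\<close> secures the order of the two constants that
      \<open>spectral_densities\<close> demands, with no comparison of \<open>k\<close> and
      \<open>C\<close>.\<close>
    have bounds: "AE \<theta> in torus_measure. hermitian (P \<tau> \<theta>) \<and>
        loewner_le (k *\<^sub>R mat 1) (P \<tau> \<theta>) \<and> loewner_le (P \<tau> \<theta>) (max k C *\<^sub>R mat 1)"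
      using good
    proof eventually_elim
      case (elim \<theta>)
      have "C * (norm x)\<^sup>2 \<le> max k C * (norm x)\<^sup>2" for x :: "complex^'m"
        by (intro mult_right_mono) auto
      then have "x \<bullet> (P \<tau> \<theta> *v x) \<le> max k C * (norm x)\<^sup>2" for x
        using P_bounds[OF \<tau> elim] order_trans by blast
      moreover have "hermitian (P \<tau> \<theta>)"
        using P_bounds[OF \<tau> elim] by (simp add: pos_def_inner)
      ultimately show ?case
        using P_bounds[OF \<tau> elim]
        by (simp add: loewner_le_scaleR_mat_1_left loewner_le_scaleR_mat_1_right)
    qed
    show ?thesis
      unfolding spectral_densities_def mem_Collect_eq
    proof (intro conjI exI allI)
      show "0 < k" "k \<le> max k C" using k by auto
    qed (rule P_meas[OF \<tau>] real bounds)+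
  qed

  have F_01: "F 0 \<theta> ** conj_transpose (F 0 \<theta>) = \<Phi>0 \<theta>" "F 1 \<theta> ** conj_transpose (F 1 \<theta>) = \<Phi>1 \<theta>"
    if "good \<theta>" for \<theta>
  proof -
    interpret d: density_pair "\<Phi>0 \<theta>" "\<Phi>1 \<theta>" "\<Omega> \<theta>" using that by (simp add: good_def)
    show "F 0 \<theta> ** conj_transpose (F 0 \<theta>) = \<Phi>0 \<theta>" "F 1 \<theta> ** conj_transpose (F 1 \<theta>) = \<Phi>1 \<theta>"
      unfolding F_good[OF that] by (rule d.F_0 d.F_1)+
  qed
  define J where "J = (\<integral>\<theta>. (weighted_norm (\<Omega> \<theta>) (F 0 \<theta> - F 1 \<theta>))\<^sup>2 \<partial>torus_measure)"
  \<comment> \<open>Stated for densities that match the factorized points almost everywhere, so that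
    it covers \<open>P \<sigma>\<close> and \<open>P \<tau>\<close> as well as the given end
    points.\<close>
  have dist: "hellinger_dist \<Omega> \<Phi> \<Psi> = sqrt ((\<sigma> - \<tau>)\<^sup>2 * J)"
    if \<sigma>: "\<sigma> \<in> {0..1}" and \<tau>: "\<tau> \<in> {0..1}"
      and \<Phi>: "\<Phi> \<in> spectral_densities" "AE \<theta> in torus_measure. \<Phi> \<theta> = F \<sigma> \<theta> ** conj_transpose (F \<sigma> \<theta>)"
      and \<Psi>: "\<Psi> \<in> spectral_densities" "AE \<theta> in torus_measure. \<Psi> \<theta> = F \<tau> \<theta> ** conj_transpose (F \<tau> \<theta>)"
    for \<sigma> \<tau> \<Phi> \<Psi>
  proof -
    obtain K1 where K1: "AE \<theta> in torus_measure. pos_def (\<Phi> \<theta>) \<and> norm (\<Phi> \<theta>) \<le> K1"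
      using AE_norm_spectral_density[OF \<Phi>(1)] .
    obtain K2 where K2: "AE \<theta> in torus_measure. pos_def (\<Psi> \<theta>) \<and> norm (\<Psi> \<theta>) \<le> K2"
      using AE_norm_spectral_density[OF \<Psi>(1)] .
    have "hellinger_dist \<Omega> \<Phi> \<Psi> = sqrt (\<integral>\<theta>. (weighted_norm (\<Omega> \<theta>) (F \<sigma> \<theta> - F \<tau> \<theta>))\<^sup>2 \<partial>torus_measure)"
    proof (rule hellinger_dist_factorization)
      show "\<Phi> \<in> borel_measurable torus_measure" "\<Psi> \<in> borel_measurable torus_measure"
        using \<Phi>(1) \<Psi>(1) by (auto simp: spectral_densities_def)
      show "AE \<theta> in torus_measure. norm (\<Phi> \<theta>) \<le> max w' (max K1 K2) \<and>
          norm (\<Psi> \<theta>) \<le> max w' (max K1 K2) \<and> norm (\<Omega> \<theta>) \<le> max w' (max K1 K2)"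
        using K1 K2 AE_torus by eventually_elim (auto simp: le_max_iff_disj w')
      show "AE \<theta> in torus_measure. pos_def (\<Phi> \<theta>) \<and> pos_semidef (\<Omega> \<theta>) \<and>
          \<Phi> \<theta> = F \<sigma> \<theta> ** conj_transpose (F \<sigma> \<theta>) \<and> \<Psi> \<theta> = F \<tau> \<theta> ** conj_transpose (F \<tau> \<theta>) \<and>
          pos_semidef (conj_transpose (F \<sigma> \<theta>) ** \<Omega> \<theta> ** F \<tau> \<theta>)"
        using K1 \<Phi>(2) \<Psi>(2) good
      proof eventually_elim
        case (elim \<theta>)
        interpret d: density_pair "\<Phi>0 \<theta>" "\<Phi>1 \<theta>" "\<Omega> \<theta>" using elim by (simp add: good_def)
        have "pos_semidef (conj_transpose (F \<sigma> \<theta>) ** \<Omega> \<theta> ** F \<tau> \<theta>)"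
          using d.pos_semidef_F_W_F[OF \<sigma> \<tau>] elim by (simp add: F_good)
        then show ?case using elim pos_def_imp_pos_semidef[OF d.W] by blast
      qed
    qed (rule \<Omega>_meas F_meas)+
    also have "F \<sigma> \<theta> - F \<tau> \<theta> = (\<tau> - \<sigma>) *\<^sub>R (F 0 \<theta> - F 1 \<theta>)" for \<theta>
      by (simp add: F_path algebra_simps)
    then have "(\<lambda>\<theta>. (weighted_norm (\<Omega> \<theta>) (F \<sigma> \<theta> - F \<tau> \<theta>))\<^sup>2)
        = (\<lambda>\<theta>. (\<sigma> - \<tau>)\<^sup>2 * (weighted_norm (\<Omega> \<theta>) (F 0 \<theta> - F 1 \<theta>))\<^sup>2)"
      by (simp only: weighted_norm_scaleR power_mult_distrib power2_abs power2_commute[of \<tau> \<sigma>])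
    finally show ?thesis by (simp add: J_def)
  qed
  have J: "0 \<le> J" by (simp add: J_def)
  have endpoints: "AE \<theta> in torus_measure. \<Phi>0 \<theta> = F 0 \<theta> ** conj_transpose (F 0 \<theta>)"
    "AE \<theta> in torus_measure. \<Phi>1 \<theta> = F 1 \<theta> ** conj_transpose (F 1 \<theta>)"
    using good by (eventually_elim, simp add: F_01)+
  have dist01: "hellinger_dist \<Omega> \<Phi>0 \<Phi>1 = sqrt J"
    using dist[of 0 1 \<Phi>0 \<Phi>1] assms(1,2) endpoints by simp
  have P_AE: "AE \<theta> in torus_measure. P \<tau> \<theta> = F \<tau> \<theta> ** conj_transpose (F \<tau> \<theta>)" if "\<tau> \<in> {0..1}" for \<tau>
    using AE_torus by eventually_elim (rule P_F[OF that])

  have "all_pass U"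
    unfolding all_pass_def using good
  proof eventually_elim
    case (elim \<theta>)
    interpret d: density_pair "\<Phi>0 \<theta>" "\<Phi>1 \<theta>" "\<Omega> \<theta>" using elim by (simp add: good_def)
    have "U \<theta> = d.U"
      using elim by (simp add: U_eq good_def d.U_def d.A_def d.B_def d.M_def)
    then show ?case using d.U_unitary by simp
  qed
  moreover have "(hellinger_dist \<Omega> \<Phi>0 \<Phi>1)\<^sup>2 =
      (\<integral>\<theta>. (weighted_norm (\<Omega> \<theta>) (psd_sqrt (\<Phi>0 \<theta>) - psd_sqrt (\<Phi>1 \<theta>) ** U \<theta>))\<^sup>2 \<partial>torus_measure)"
    using J by (simp add: dist01 J_def F_path)
  moreover have "is_hellinger_geodesic \<Omega> P \<Phi>0 \<Phi>1"
    unfolding is_hellinger_geodesic_def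
  proof (intro conjI ballI)
    show "AE \<theta> in torus_measure. P 0 \<theta> = \<Phi>0 \<theta>"
      using P_AE[of 0] endpoints(1) by (auto elim: eventually_elim2)
    show "AE \<theta> in torus_measure. P 1 \<theta> = \<Phi>1 \<theta>"
      using P_AE[of 1] endpoints(2) by (auto elim: eventually_elim2)
    fix \<sigma> \<tau> :: real assume "\<sigma> \<in> {0..1}" "\<tau> \<in> {0..1}"
    then show "hellinger_dist \<Omega> (P \<sigma>) (P \<tau>) = \<bar>\<sigma> - \<tau>\<bar> * hellinger_dist \<Omega> \<Phi>0 \<Phi>1"
      using dist P_density P_AE by (simp add: dist01 real_sqrt_mult)
  qed (rule P_density)
  ultimately show ?thesis by blast
qed

end
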